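(* Let $K$ be a field, $V$ a $K$-module, and let $(V,G)$ be a $PI$-representation of a group $G$ in $V$. Then there exists a unipotent radical of $(V,G)$, and it coincides with the locally unitriangular radical of $(V,G)$.
   Context: Let $K$ be a field and $V$ a $K$-module (vector space, not assumed finite-dimensional). A representation $(V,G)$ of a group $G$ in $V$ is a homomorphism $\rho:G\to \mathrm{Aut}\,V$, $g\mapsto g^{\rho}$; it is written as a right action $v\circ g=g^{\rho}(v)$, with $v\circ(gh)=(v\circ g)\circ h$, and extends linearly to an action of the group algebra $KG$ on $V$. For a subgroup $H\le G$, $(V,H)$ denotes the restriction of the representation to $H$. An element $g\in G$ is a unipotent element of $(V,G)$ if there is $n=n(g)$ such that $x\circ (g-1)^{n}=0$ for every $x\in V$. The representation $(V,G)$ is unipotent if every $g\in G$ is a unipotent element of $(V,G)$. The representation $(V,G)$ is unitriangular if for some $n$ it satisfies the identity $x\circ (y_1-1)\cdots (y_n-1)\equiv 0$, i.e. $v\circ (g_1-1)\cdots(g_n-1)=0$ for all $v\in V$ and all $g_1,\dots,g_n\in G$. It is locally unitriangular if for every finitely generated subgroup $H$ of $G$ the subrepresentation $(V,H)$ is unitriangular. Let $\mathrm{Ker}(V,G)=\{g\in G: v\circ g=v \text{ for all } v\in V\}$ and $\overline G=G/\mathrm{Ker}(V,G)$, regarded as a subgroup of $\mathrm{Aut}\,V$ via the corresponding faithful representation $(V,\overline G)$. The representation $(V,G)$ is a $PI$-representation if the linear span $\langle\overline G\rangle$ of $\overline G$ in the algebra $\mathrm{End}\,V$ (of $K$-linear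 endomorphisms of $V$) is a $PI$-algebra, i.e. satisfies some non-trivial polynomial identity over $K$. The locally unitriangular radical of a representation $(V,G)$ is the unique maximal normal subgroup $H$ of $G$ such that the subrepresentation $(V,H)$ is locally unitriangular; it is known that it exists for every representation of a group. The unipotent radical of $(V,G)$, if it exists, is the unique maximal normal subgroup $H$ of $G$ such that the subrepresentation $(V,H)$ is unipotent. *)

theory Defs
  imports
    Complex_Main
    "HOL-Algebra.Coset"
    "HOL-Algebra.Generated_Groups"
    "HOL-Library.Function_Algebras"
    "HOL-Library.Poly_Mapping"
begin

(* All endomorphisms act on the right, so the product of f and g is "first f, then g".
   The vector space is given by an additive group type together with a scalar
   multiplication (locale vector_space); it is not assumed finite-dimensional. *)

definition aut_group :: "('k::field \<Rightarrow> 'v::ab_group_add \<Rightarrow> 'v) \<Rightarrow> ('v \<Rightarrow> 'v) monoid" where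
  "aut_group scale =
     \<lparr>carrier = {f. Vector_Spaces.linear scale scale f \<and> bij f}, mult = (\<lambda>f g. g \<circ> f), one = id\<rparr>"

locale group_rep = vector_space scale + group G
  for scale :: "'k::field \<Rightarrow> 'v::ab_group_add \<Rightarrow> 'v"
  and G :: "('g, 'b) monoid_scheme"
  and \<rho> :: "'g \<Rightarrow> 'v \<Rightarrow> 'v" +
  assumes hom_rho: "\<rho> \<in> hom G (aut_group scale)"

(* The action of the element g - 1 of the group algebra. *)
definition act_minus_one :: "('g \<Rightarrow> 'v \<Rightarrow> 'v::ab_group_add) \<Rightarrow> 'g \<Rightarrow> 'v \<Rightarrow> 'v" where
  "act_minus_one \<rho> g v = \<rho> g v - v"

(* The restriction (V,H) of a representation of G to a subgroup H is the same map \<rho>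
   with the group G\<lparr>carrier := H\<rparr>. *)

definition unipotent_rep :: "('g, 'b) monoid_scheme \<Rightarrow> ('g \<Rightarrow> 'v \<Rightarrow> 'v::ab_group_add) \<Rightarrow> bool" where
  "unipotent_rep G \<rho> \<longleftrightarrow> (\<forall>g\<in>carrier G. \<exists>n::nat. \<forall>x. (act_minus_one \<rho> g ^^ n) x = 0)"

definition unitriangular_rep :: "('g, 'b) monoid_scheme \<Rightarrow> ('g \<Rightarrow> 'v \<Rightarrow> 'v::ab_group_add) \<Rightarrow> bool" where
  "unitriangular_rep G \<rho> \<longleftrightarrow>
     (\<exists>n::nat. \<forall>v gs. length gs = n \<and> set gs \<subseteq> carrier G \<longrightarrow>
        foldl (\<lambda>x g. act_minus_one \<rho> g x) v gs = 0)"

definition locally_unitriangular_rep :: "('g, 'b) monoid_scheme \<Rightarrow> ('g \<Rightarrow> 'v \<Rightarrow> 'v::ab_group_add) \<Rightarrow> bool" where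
  "locally_unitriangular_rep G \<rho> \<longleftrightarrow>
     (\<forall>S. finite S \<and> S \<subseteq> carrier G \<longrightarrow>
        unitriangular_rep (G\<lparr>carrier := generate G S\<rparr>) \<rho>)"

definition rep_ker :: "('g, 'b) monoid_scheme \<Rightarrow> ('g \<Rightarrow> 'v \<Rightarrow> 'v) \<Rightarrow> 'g set" where
  "rep_ker G \<rho> = {g \<in> carrier G. \<forall>v. \<rho> g v = v}"

(* The quotient group G / Ker(V,G), embedded in Aut V by the induced faithful representation. *)
definition faithful_image :: "('g, 'b) monoid_scheme \<Rightarrow> ('g \<Rightarrow> 'v \<Rightarrow> 'v) \<Rightarrow> ('v \<Rightarrow> 'v) set" where
  "faithful_image G \<rho> = (\<lambda>C. the_elem (\<rho> ` C)) ` carrier (G Mod rep_ker G \<rho>)"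

(* Elements of the free associative algebra K<X0, X1, ...>: finitely supported coefficient
   functions on words, where the word [i1, ..., ir] is the monomial X(i1) ... X(ir). *)
type_synonym 'k nc_poly = "nat list \<Rightarrow>\<^sub>0 'k"

definition nc_eval ::
  "('k \<Rightarrow> 'a \<Rightarrow> 'a) \<Rightarrow> ('a \<Rightarrow> 'a \<Rightarrow> 'a) \<Rightarrow> 'a \<Rightarrow> (nat \<Rightarrow> 'a) \<Rightarrow> ('k::field) nc_poly \<Rightarrow> 'a::ab_group_add" where
  "nc_eval smul mul e a p =
     (\<Sum>w\<in>Poly_Mapping.keys p. smul (Poly_Mapping.lookup p w) (foldr mul (map a w) e))"

(* A is the carrier of a subalgebra of the ambient K-algebra with scalar multiplication smul,
   multiplication mul and unit e. *)
definition PI_algebra ::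
  "('k::field \<Rightarrow> 'a \<Rightarrow> 'a) \<Rightarrow> ('a \<Rightarrow> 'a \<Rightarrow> 'a) \<Rightarrow> 'a \<Rightarrow> 'a::ab_group_add set \<Rightarrow> bool" where
  "PI_algebra smul mul e A \<longleftrightarrow>
     (\<exists>p :: 'k nc_poly. p \<noteq> 0 \<and> (\<forall>a. (\<forall>i. a i \<in> A) \<longrightarrow> nc_eval smul mul e a p = 0))"

(* Scalar multiplication on maps V \<rightarrow> V; addition of maps is pointwise (Function_Algebras). *)
definition end_scale :: "('k \<Rightarrow> 'v \<Rightarrow> 'v) \<Rightarrow> 'k \<Rightarrow> ('v \<Rightarrow> 'v) \<Rightarrow> 'v \<Rightarrow> 'v" where
  "end_scale scale c f = (\<lambda>v. scale c (f v))"

definition PI_rep ::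
  "('k::field \<Rightarrow> 'v::ab_group_add \<Rightarrow> 'v) \<Rightarrow> ('g, 'b) monoid_scheme \<Rightarrow> ('g \<Rightarrow> 'v \<Rightarrow> 'v) \<Rightarrow> bool" where
  "PI_rep scale G \<rho> \<longleftrightarrow>
     PI_algebra (end_scale scale) (\<lambda>f g. g \<circ> f) id
       (module.span (end_scale scale) (faithful_image G \<rho>))"

definition maximal_normal_with ::
  "('g set \<Rightarrow> bool) \<Rightarrow> ('g, 'b) monoid_scheme \<Rightarrow> 'g set \<Rightarrow> bool" where
  "maximal_normal_with P G H \<longleftrightarrow>
     H \<lhd> G \<and> P H \<and> (\<forall>N. N \<lhd> G \<and> P N \<and> H \<subseteq> N \<longrightarrow> N = H)"

definition unique_maximal_normal_with ::
  "('g set \<Rightarrow> bool) \<Rightarrow> ('g, 'b) monoid_scheme \<Rightarrow> 'g set \<Rightarrow> bool" where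
  "unique_maximal_normal_with P G H \<longleftrightarrow>
     maximal_normal_with P G H \<and> (\<forall>N. maximal_normal_with P G N \<longrightarrow> N = H)"

definition is_unipotent_radical ::
  "('g, 'b) monoid_scheme \<Rightarrow> ('g \<Rightarrow> 'v \<Rightarrow> 'v::ab_group_add) \<Rightarrow> 'g set \<Rightarrow> bool" where
  "is_unipotent_radical G \<rho> H \<longleftrightarrow>
     unique_maximal_normal_with (\<lambda>N. unipotent_rep (G\<lparr>carrier := N\<rparr>) \<rho>) G H"

definition is_locally_unitriangular_radical ::
  "('g, 'b) monoid_scheme \<Rightarrow> ('g \<Rightarrow> 'v \<Rightarrow> 'v::ab_group_add) \<Rightarrow> 'g set \<Rightarrow> bool" where
  "is_locally_unitriangular_radical G \<rho> H \<longleftrightarrow>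
     unique_maximal_normal_with (\<lambda>N. locally_unitriangular_rep (G\<lparr>carrier := N\<rparr>) \<rho>) G H"

lemma (in vector_space) aut_group_is_group: "group (aut_group scale)"
proof (rule groupI)
  fix f assume f: "f \<in> carrier (aut_group scale)"
  then have l: "Vector_Spaces.linear scale scale f" and b: "bij f"
    by (auto simp: aut_group_def)
  interpret f: Vector_Spaces.linear scale scale f by (fact l)
  have "Vector_Spaces.linear scale scale (inv_into UNIV f)"
  proof (unfold_locales)
    show "inv_into UNIV f (x + y) = inv_into UNIV f x + inv_into UNIV f y" for x y
      by (metis b bij_inv_eq_iff f.add)
    show "inv_into UNIV f (scale r x) = scale r (inv_into UNIV f x)" for r x
      by (metis b bij_inv_eq_iff f.scale)
  qed
  then show "\<exists>g\<in>carrier (aut_group scale). g \<otimes>\<^bsub>aut_group scale\<^esub> f = \<one>\<^bsub>aut_group scale\<^esub>"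
    using b by (intro bexI[of _ "inv_into UNIV f"])
      (auto simp: aut_group_def bij_imp_bij_inv bij_is_surj surj_f_inv_f fun_eq_iff)
next
  show "\<one>\<^bsub>aut_group scale\<^esub> \<in> carrier (aut_group scale)"
    by (simp add: aut_group_def linear_id)
qed (auto simp: aut_group_def comp_assoc bij_comp intro: Vector_Spaces.linear_compose)

lemma (in group_rep) faithful_image_eq: "faithful_image G \<rho> = \<rho> ` carrier G"
proof -
  interpret h: group_hom G "aut_group scale" \<rho>
    by (intro group_hom.intro group_hom_axioms.intro)
      (auto simp: hom_rho aut_group_is_group intro: is_group)
  have ker: "rep_ker G \<rho> = kernel G (aut_group scale) \<rho>"
    by (auto simp: rep_ker_def kernel_def aut_group_def fun_eq_iff)
  have const: "the_elem (\<rho> ` (rep_ker G \<rho> #>\<^bsub>G\<^esub> g)) = \<rho> g" if g: "g \<in> carrier G" for g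
  proof (rule the_elem_image_unique)
    show "rep_ker G \<rho> #>\<^bsub>G\<^esub> g \<noteq> {}"
      using h.normal_kernel g rcos_self[OF g normal_imp_subgroup] unfolding ker by blast
    show "\<rho> y = \<rho> g" if "y \<in> rep_ker G \<rho> #>\<^bsub>G\<^esub> g" for y
      using that g by (auto simp: r_coset_def ker kernel_def)
  qed
  show ?thesis
    unfolding faithful_image_def FactGroup_def RCOSETS_def
    using const by force
qed

end

theory Submission
  imports
    Defs
    "HOL-Library.Sublist"
    "HOL-Combinatorics.Multiset_Permutations"
    "HOL-Computational_Algebra.Polynomial_FPS"
    "HOL-Algebra.SndIsomorphismGrp"
    "Jordan_Normal_Form.Determinant"
begin

text \<open>Everything rests on the claim that a finitely generated unipotent group \<open>H\<close> whose linear span is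
  a PI-algebra is unitriangular; granting it, unipotent and locally unitriangular normal subgroups are
  the same. A multilinear identity rewrites decomposable words in the generators of \<open>H\<close> by smaller
  ones, and by Shirshov's theorem a long word that is not decomposable contains a high power of a short
  word; since all words are unipotent, this power reduces as well, and the span of \<open>H\<close> is
  finite-dimensional. In the regular representation, \<open>det (1 - t \<Sum> c\<^sub>i h\<^sub>i) = (1 - t \<Sum> c\<^sub>i)\<^sup>n\<close>
  for \<open>h\<^sub>i \<in> H\<close> over any field, because the left-hand side is an infinite product of factors
  \<open>det (1 - t\<^sup>l c h)\<close> with \<open>h \<in> H\<close>, each depending only on \<open>t\<^sup>l c\<close>. Hence the augmentation ideal is nil,
  and a second application of Shirshov's theorem, to words in the \<open>h - 1\<close>, makes it nilpotent.

  The radical is the union of all unipotent normal subgroups. It is closed under products since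
  a product of two unipotent normal subgroups is unipotent.\<close>

section \<open>Shirshov's theorem on words\<close>

text \<open>Traces cannot drive the finite-dimensional step: in characteristic \<open>p\<close> an
  element all of whose powers have trace zero need not be nilpotent. The determinant of
  \<open>1 - t a\<close> keeps the whole characteristic polynomial, and it equals 1 only for
  nilpotent \<open>a\<close>. Nor can the augmentation serve as a map, since linear relations
  between group elements might not respect it; each formal sum therefore carries its scalar shadow
  along, and the elements of interest have shadow zero.

  The two word reductions need different orders. A power of a unipotent word is a combination of
  shorter words, so there the order must compare lengths first. In the second reduction powers
  vanish outright; an order within each length suffices, and a word longer than all irreducible ones
  is then zero.\<close>

definition factor_closed :: "'b list set \<Rightarrow> bool" where
  "factor_closed L \<longleftrightarrow> (\<forall>v\<in>L. \<forall>w. sublist w v \<longrightarrow> w \<in> L)"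

lemma factor_closedD: "factor_closed L \<Longrightarrow> v \<in> L \<Longrightarrow> sublist w v \<Longrightarrow> w \<in> L"
  unfolding factor_closed_def by blast

lemma finite_bounded_words:
  fixes L :: "'b list set"
  assumes "L \<subseteq> lists A" "finite A" "\<And>w. w \<in> L \<Longrightarrow> length w \<le> l"
  shows "finite L"
  by (rule finite_subset[OF _ finite_lists_length_le[OF assms(2), of l]]) (use assms in auto)

lemma long_word_ex:
  assumes "L \<subseteq> lists A" "finite A" "infinite L"
  obtains w where "w \<in> L" "length w > l"
  using finite_bounded_words[OF assms(1,2), of l] assms(3) by (meson not_less)

lemma exact_length_word_ex:
  assumes "L \<subseteq> lists A" "finite A" "infinite L" "factor_closed L"
  obtains w where "w \<in> L" "length w = l"
proof -
  obtain w where w: "w \<in> L" "length w > l"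
    using long_word_ex[OF assms(1-3)] .
  have "take l w \<in> L"
    using factor_closedD[OF assms(4) w(1)] by (simp add: prefix_imp_sublist take_is_prefix)
  with w that[of "take l w"] show ?thesis by simp
qed

text \<open>Zorn's lemma on complements. A chain cannot leave only finitely many words: there are
  finitely many words of each length, so one member of the chain would already remove all words of
  some length, while an infinite factorial language over a finite alphabet has words of every
  length.\<close>

lemma minimal_language:
  fixes F :: "'b list set"
  assumes F: "F \<subseteq> lists A" "finite A" "infinite F" "factor_closed F"
  obtains L where "L \<subseteq> F" "infinite L" "factor_closed L"
    "\<And>L'. L' \<subseteq> L \<Longrightarrow> infinite L' \<Longrightarrow> factor_closed L' \<Longrightarrow> L' = L"
proof -
  define \<A> where "\<A> = {X. infinite (F - X) \<and> factor_closed (F - X) \<and> X \<subseteq> F}"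
  have "\<exists>M\<in>\<A>. \<forall>X\<in>\<A>. M \<subseteq> X \<longrightarrow> X = M"
  proof (rule subset_Zorn_nonempty)
    have "{} \<in> \<A>" using F by (simp add: \<A>_def)
    then show "\<A> \<noteq> {}" by blast
  next
    fix \<C> assume ne: "\<C> \<noteq> {}" and ch: "subset.chain \<A> \<C>"
    then have sub: "\<And>X. X \<in> \<C> \<Longrightarrow> X \<in> \<A>" by (auto simp: subset.chain_def)
    have fc: "factor_closed (F - \<Union>\<C>)"
      unfolding factor_closed_def
    proof (intro ballI allI impI)
      fix v w assume v: "v \<in> F - \<Union>\<C>" and w: "sublist w v"
      have "w \<in> F - X" if "X \<in> \<C>" for X
        using sub[OF that] v w that unfolding \<A>_def by (auto dest: factor_closedD)
      with ne show "w \<in> F - \<Union>\<C>" by blast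
    qed
    have "infinite (F - \<Union>\<C>)"
    proof
      assume fin: "finite (F - \<Union>\<C>)"
      define l where "l = Suc (Max (insert 0 (length ` (F - \<Union>\<C>))))"
      have short: "length w < l" if "w \<in> F - \<Union>\<C>" for w
        using that fin unfolding l_def by (auto intro!: le_imp_less_Suc Max_ge)
      let ?W = "{w \<in> F. length w = l}"
      have "finite ?W"
        by (rule finite_bounded_words[OF _ F(2), of _ l]) (use F(1) in auto)
      moreover have "?W \<subseteq> \<Union>\<C>" using short by blast
      ultimately obtain X where X: "X \<in> \<C>" "?W \<subseteq> X"
        using finite_subset_Union_chain[OF _ _ ne ch] by metis
      from sub[OF X(1)] have "infinite (F - X)" "factor_closed (F - X)" by (auto simp: \<A>_def)
      with F(1,2) obtain w where "w \<in> F - X" "length w = l"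
        using exact_length_word_ex[of "F - X" A l] by blast
      with X(2) show False by blast
    qed
    with fc sub show "\<Union>\<C> \<in> \<A>" unfolding \<A>_def by blast
  qed
  then obtain M where M: "M \<in> \<A>" "\<And>X. X \<in> \<A> \<Longrightarrow> M \<subseteq> X \<Longrightarrow> X = M" by blast
  show ?thesis
  proof (rule that[of "F - M"])
    show "infinite (F - M)" "factor_closed (F - M)" using M(1) by (auto simp: \<A>_def)
    fix L' assume L': "L' \<subseteq> F - M" "infinite L'" "factor_closed L'"
    then have eq: "F - (F - L') = L'" by blast
    have "F - L' \<in> \<A>" unfolding \<A>_def using L' by (simp add: eq)
    moreover have "M \<subseteq> F - L'" using L'(1) M(1) by (auto simp: \<A>_def)
    ultimately have "F - L' = M" using M(2) by blast
    then show "L' = F - M" using eq by blast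
  qed auto
qed

text \<open>The words of \<open>L\<close> that avoid \<open>w\<close> form a factorial sublanguage
  different from \<open>L\<close>; by minimality it is finite, so their lengths are bounded.\<close>

lemma minimal_language_recurrent:
  assumes "L \<subseteq> lists A" "finite A" "infinite L" "factor_closed L"
    and min: "\<And>L'. L' \<subseteq> L \<Longrightarrow> infinite L' \<Longrightarrow> factor_closed L' \<Longrightarrow> L' = L"
    and w: "w \<in> L"
  shows "\<exists>N. \<forall>v\<in>L. N < length v \<longrightarrow> sublist w v"
proof -
  let ?L' = "{v \<in> L. \<not> sublist w v}"
  have "factor_closed ?L'"
    unfolding factor_closed_def using assms(4) by (auto simp: factor_closed_def dest: sublist_order.order_trans)
  moreover have "?L' \<noteq> L" using w by auto
  ultimately have fin: "finite ?L'" using min[of ?L'] by blast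
  have "sublist w v" if "v \<in> L" "Max (insert 0 (length ` ?L')) < length v" for v
  proof (rule ccontr)
    assume "\<not> sublist w v"
    with that(1) have "length v \<in> length ` ?L'" by blast
    with fin have "length v \<le> Max (insert 0 (length ` ?L'))" by (intro Max_ge) auto
    with that(2) show False by simp
  qed
  then show ?thesis by blast
qed

text \<open>Cut \<open>v\<close> into pieces of length \<open>N\<close> and find one
  \<open>c\<close> in each piece. A block runs from one occurrence to the next, which is why the
  part \<open>pre\<close> before the next occurrence is joined to the current block.\<close>

lemma cut_into_blocks:
  assumes L: "factor_closed L" and N: "\<And>c v. c \<in> set cs \<Longrightarrow> v \<in> L \<Longrightarrow> N \<le> length v \<Longrightarrow> sublist c v"
    and v: "v \<in> L" "length cs * N \<le> length v"
  shows "\<exists>pre us. v = pre @ concat us \<and> list_all2 prefix cs us"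
  using N v
proof (induction cs arbitrary: v)
  case Nil
  then show ?case by (intro exI[of _ v] exI[of _ "[]"]) auto
next
  case (Cons c cs)
  have "take N v \<in> L" "drop N v \<in> L"
    using factor_closedD[OF L Cons.prems(2)] by (simp_all add: sublist_take sublist_drop)
  then have "sublist c (take N v)" using Cons.prems by simp
  then obtain p s where ps: "take N v = p @ c @ s" unfolding sublist_def by blast
  have "length cs * N \<le> length (drop N v)" using Cons.prems(3) by simp
  then obtain pre us where us: "drop N v = pre @ concat us" "list_all2 prefix cs us"
    using Cons.IH[OF _ \<open>drop N v \<in> L\<close>] Cons.prems(1) by fastforce
  have "v = take N v @ drop N v" by simp
  also have "\<dots> = p @ concat ((c @ s @ pre) # us)" using ps us(1) by simp
  finally show ?case using us(2) by (intro exI[of _ p] exI[of _ "(c @ s @ pre) # us"]) auto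
qed

text \<open>\<open>lex less_than\<close> relates only words of equal length, so it is total on the
  set at hand but not on the type. The enumeration is built by removing a greatest element
  repeatedly.\<close>

lemma sorted_wrt_enumeration:
  assumes "finite C" "trans r" "total_on C r" "irrefl r"
  shows "\<exists>cs. set cs = C \<and> distinct cs \<and> sorted_wrt (\<lambda>x y. (y, x) \<in> r) cs"
  using assms(1,3)
proof (induction "card C" arbitrary: C)
  case 0
  then show ?case by auto
next
  case (Suc k)
  then have "C \<noteq> {}" by auto
  have "\<exists>m\<in>C. \<forall>x\<in>C. x \<noteq> m \<longrightarrow> (m, x) \<notin> r"
    by (rule Finite_Set.bex_max_element[OF Suc.prems(1) _ _ \<open>C \<noteq> {}\<close>])
      (use assms(2,4) in \<open>auto intro!: asymp_onI transp_onI dest: transD irreflD\<close>)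
  then obtain m where m: "m \<in> C" "\<And>x. x \<in> C \<Longrightarrow> x \<noteq> m \<Longrightarrow> (x, m) \<in> r"
    using Suc.prems(2) unfolding total_on_def by blast
  obtain cs where cs: "set cs = C - {m}" "distinct cs" "sorted_wrt (\<lambda>x y. (y, x) \<in> r) cs"
    using Suc.hyps(1)[of "C - {m}"] Suc.hyps(2)[symmetric] Suc.prems m(1)
      total_on_subset[OF Suc.prems(2), of "C - {m}"] by auto
  then show ?case using m by (intro exI[of _ "m # cs"]) auto
qed

text \<open>A power of the period that fits into the first \<open>K\<close> letters also starts at
  position \<open>p\<close>; putting the period in front of it raises the exponent by one.\<close>

lemma power_prefix:
  assumes "k * p \<le> K + p" "K + p \<le> length y" "take K (drop p y) = take K y"
  shows "prefix (concat (replicate k (take p y))) y"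
  using assms(1)
proof (induction k)
  case (Suc k)
  let ?c = "concat (replicate k (take p y))"
  have len: "length ?c = k * p" using assms(2) by (simp add: length_concat sum_list_replicate)
  have "prefix ?c y" using Suc by simp
  then have "prefix ?c (take K y)" using Suc.prems len assms(2)
    by (intro prefix_length_prefix[OF _ take_is_prefix]) auto
  then have "prefix ?c (drop p y)"
    by (metis assms(3) prefix_order.trans take_is_prefix)
  then have "prefix (take p y @ ?c) (take p y @ drop p y)" by (subst same_prefix_prefix)
  then show ?case by simp
qed simp

text \<open>Passing to a minimal infinite factorial sublanguage makes every
  factor recur in every long word. If there are \<open>n\<close> words of one length, they
  can be found in decreasing order; otherwise two of the first \<open>n\<close> suffixes of a long word agree on a long
  prefix, which forces a short period.\<close>

lemma shirshov_words:
  fixes F :: "nat list set"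
  assumes F: "F \<subseteq> lists A" "finite A" "infinite F" "factor_closed F"
  shows "(\<exists>l cs us. length cs = n \<and> sorted_wrt (\<lambda>x y. (y, x) \<in> lex less_than) cs \<and>
            list_all2 prefix cs us \<and> (\<forall>c\<in>set cs. length c = l) \<and> concat us \<in> F) \<or>
         (\<exists>u. u \<noteq> [] \<and> length u \<le> n \<and> concat (replicate k u) \<in> F)"
proof -
  obtain L where L: "L \<subseteq> F" "infinite L" "factor_closed L"
    and min: "\<And>L'. L' \<subseteq> L \<Longrightarrow> infinite L' \<Longrightarrow> factor_closed L' \<Longrightarrow> L' = L"
    using minimal_language[OF F] by blast
  have LA: "L \<subseteq> lists A" using L(1) F(1) by blast
  have finl: "finite {w \<in> L. length w = l}" for l
    by (rule finite_bounded_words[OF _ F(2), of _ l]) (use LA in auto)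
  show ?thesis
  proof (cases "\<exists>l. n \<le> card {w \<in> L. length w = l}")
    case True
    then obtain l where "n \<le> card {w \<in> L. length w = l}" by blast
    then obtain C where C: "C \<subseteq> {w \<in> L. length w = l}" "card C = n" "finite C"
      using finl by (meson obtain_subset_with_card_n)
    have "total_on C (lex less_than)"
    proof (rule total_onI)
      fix x y assume "x \<in> C" "y \<in> C" "x \<noteq> y"
      then have "length x = length y" using C(1) by auto
      moreover have "(x, y) \<in> lenlex less_than \<or> (y, x) \<in> lenlex less_than"
        using total_lenlex[OF total_less_than] \<open>x \<noteq> y\<close> unfolding total_on_def by blast
      ultimately show "(x, y) \<in> lex less_than \<or> (y, x) \<in> lex less_than"
        by (auto simp: lenlex_conv simp del: less_than_iff)
    qed
    then obtain cs where cs: "set cs = C" "distinct cs" "sorted_wrt (\<lambda>x y. (y, x) \<in> lex less_than) cs"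
      using sorted_wrt_enumeration[OF C(3) lex_transI[OF trans_less_than]]
        wf_lex[OF wf_less_than] by (meson irreflI wf_not_refl)
    have "\<exists>N. \<forall>v\<in>L. N < length v \<longrightarrow> sublist c v" if "c \<in> C" for c
      using minimal_language_recurrent[OF LA F(2) L(2,3) min] C(1) that by blast
    then have "\<forall>c\<in>C. \<exists>N. \<forall>v\<in>L. N < length v \<longrightarrow> sublist c v" by blast
    from bchoice[OF this]
    obtain N where N: "\<And>c v. c \<in> C \<Longrightarrow> v \<in> L \<Longrightarrow> N c < length v \<Longrightarrow> sublist c v" by blast
    define M where "M = Suc (Max (insert 0 (N ` C)))"
    have NM: "N c < M" if "c \<in> C" for c
      unfolding M_def using that C(3) by (auto intro!: le_imp_less_Suc Max_ge)
    have rec: "sublist c v" if "c \<in> set cs" "v \<in> L" "M \<le> length v" for c v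
      using that N NM[of c] cs(1) by (meson order_less_le_trans)
    obtain v where v: "v \<in> L" "length cs * M < length v" using long_word_ex[OF LA F(2) L(2)] .
    obtain pre us where us: "v = pre @ concat us" "list_all2 prefix cs us"
      using cut_into_blocks[OF L(3) rec v(1) less_imp_le[OF v(2)]] by blast
    have "concat us \<in> L" using factor_closedD[OF L(3) v(1)] us(1) by (simp add: suffix_imp_sublist suffixI)
    moreover have "length cs = n" using cs C(2) distinct_card by metis
    moreover have "\<forall>c\<in>set cs. length c = l" using cs(1) C(1) by auto
    ultimately show ?thesis using cs(3) us(2) L(1)
      by (intro disjI1 exI[of _ l] exI[of _ cs] exI[of _ us]) auto
  next
    case False
    then have small: "card {w \<in> L. length w = l} < n" for l by (simp add: not_le)
    then have "n > 0" by (metis gr0I not_less_zero)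
    \<comment> \<open>Two equal windows start fewer than \<open>n\<close> places apart, so the
      period is below \<open>n\<close> and a window of length \<open>n * k\<close> has room for
      \<open>k\<close> periods.\<close>
    define K where "K = n * k"
    obtain v where v: "v \<in> L" "n + K < length v" using long_word_ex[OF LA F(2) L(2)] .
    let ?f = "\<lambda>i. take K (drop i v)"
    have inL: "w \<in> L" if "sublist w (drop i v)" for w i
      using factor_closedD[OF L(3) v(1)] that sublist_drop by (meson sublist_order.order_trans)
    have "?f ` {..<n} \<subseteq> {w \<in> L. length w = K}"
      using v(2) by (auto intro!: inL[OF sublist_take])
    then have "card (?f ` {..<n}) < card {..<n}"
      using le_less_trans[OF card_mono[OF finl] small] by simp
    then have "\<not> inj_on ?f {..<n}" by (rule pigeonhole)
    then obtain i j where ij: "i < j" "j < n" "?f i = ?f j"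
      using linorder_inj_onI'[of "{..<n}" ?f] by auto
    let ?y = "drop i v" and ?p = "j - i"
    have "prefix (concat (replicate k (take ?p ?y))) ?y"
    proof (rule power_prefix[where K = K])
      have "?p * k \<le> K" unfolding K_def using ij by (intro mult_le_mono1) simp
      then show "k * ?p \<le> K + ?p" by (simp only: mult.commute[of k] trans_le_add1)
      show "K + ?p \<le> length ?y" using ij(1,2) v(2) by simp
      have "drop ?p ?y = drop j v" using ij(1) by simp
      then show "take K (drop ?p ?y) = take K ?y" using ij(3) by simp
    qed
    then have "concat (replicate k (take ?p ?y)) \<in> L"
      by (intro inL[OF prefix_imp_sublist])
    moreover have "take ?p ?y \<noteq> []" "length (take ?p ?y) \<le> n" using ij v(2) by auto
    ultimately show ?thesis using L(1) by blast
  qed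
qed

section \<open>Reduction of words by a multilinear identity\<close>

text \<open>Sort \<open>{ring, monoid_mult}\<close> rather than \<open>ring_1\<close>, since the endomorphism ring of the
  zero space satisfies \<open>1 = 0\<close>. The product is linear in its right argument; it is
  linear in the left argument only if the right one satisfies \<open>lin\<close>.\<close>

locale right_algebra = vector_space smul
  for smul :: "'k::field \<Rightarrow> 'a::{ring,monoid_mult} \<Rightarrow> 'a" +
  assumes mult_smul: "x * smul c y = smul c (x * y)"
begin

text \<open>In the ring \<open>endo\<close> of additive maps used at the end, these are exactly the
  \<open>K\<close>-linear maps.\<close>

definition lin :: "'a \<Rightarrow> bool" where
  "lin y \<longleftrightarrow> (\<forall>c x. smul c x * y = smul c (x * y))"

lemma smul_mult: "lin y \<Longrightarrow> smul c x * y = smul c (x * y)"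
  by (simp add: lin_def)

lemma lin_0: "lin 0" and lin_1: "lin 1"
  by (simp_all add: lin_def)

lemma lin_add: "lin x \<Longrightarrow> lin y \<Longrightarrow> lin (x + y)"
  and lin_diff: "lin x \<Longrightarrow> lin y \<Longrightarrow> lin (x - y)"
  by (simp_all add: lin_def distrib_left right_diff_distrib scale_right_distrib scale_right_diff_distrib)

lemma lin_smul: "lin x \<Longrightarrow> lin (smul c x)"
  by (simp add: lin_def mult_smul scale_left_commute)

lemma lin_mult: "lin x \<Longrightarrow> lin y \<Longrightarrow> lin (x * y)"
  by (simp add: lin_def mult.assoc[symmetric])

lemma lin_power: "lin x \<Longrightarrow> lin (x ^ k)"
  by (induction k) (auto intro: lin_1 lin_mult)

lemma lin_prod_list: "(\<And>x. x \<in> set xs \<Longrightarrow> lin x) \<Longrightarrow> lin (prod_list xs)"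
  by (induction xs) (auto intro: lin_1 lin_mult)

lemma lin_span: "(\<And>x. x \<in> X \<Longrightarrow> lin x) \<Longrightarrow> y \<in> span X \<Longrightarrow> lin y"
  by (erule span_induct_alt) (auto intro: lin_0 lin_add lin_smul)

lemma span_mult_left: "y \<in> span Y \<Longrightarrow> (\<And>b. b \<in> Y \<Longrightarrow> x * b \<in> span Z) \<Longrightarrow> x * y \<in> span Z"
  by (erule span_induct_alt) (auto intro: span_zero simp: distrib_left mult_smul span_add span_scale)

lemma span_mult_right: "x \<in> span X \<Longrightarrow> lin y \<Longrightarrow> (\<And>a. a \<in> X \<Longrightarrow> a * y \<in> span Z) \<Longrightarrow> x * y \<in> span Z"
  by (erule span_induct_alt) (auto intro: span_zero simp: distrib_right smul_mult span_add span_scale)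

lemma span_mult:
  assumes "x \<in> span X" "y \<in> span Y" "\<And>b. b \<in> Y \<Longrightarrow> lin b" "\<And>a b. a \<in> X \<Longrightarrow> b \<in> Y \<Longrightarrow> a * b \<in> span Z"
  shows "x * y \<in> span Z"
  by (rule span_mult_left[OF assms(2)], rule span_mult_right[OF assms(1)]) (use assms(3,4) in auto)

lemma span_mult_closed:
  assumes "\<And>b. b \<in> M \<Longrightarrow> lin b" "\<And>a b. a \<in> M \<Longrightarrow> b \<in> M \<Longrightarrow> a * b \<in> M" "x \<in> span M" "y \<in> span M"
  shows "x * y \<in> span M"
  by (rule span_mult[OF assms(3,4,1)]) (auto intro: span_base assms(2))

text \<open>The identity permutation must have a nonzero coefficient because it supplies the leading
  monomial: the words substituted later come in decreasing order, and any other order of them gives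
  a smaller word.\<close>

definition multilinear_identity :: "nat \<Rightarrow> (nat list \<Rightarrow> 'k) \<Rightarrow> 'a set \<Rightarrow> bool" where
  "multilinear_identity n q A \<longleftrightarrow> q [0..<n] \<noteq> 0 \<and>
     (\<forall>y. (\<forall>i. y i \<in> A) \<longrightarrow>
        (\<Sum>u\<in>permutations_of_set {..<n}. smul (q u) (prod_list (map y u))) = 0)"

definition ev :: "(nat \<Rightarrow> 'a) \<Rightarrow> nat list \<Rightarrow> 'a" where
  "ev x w = prod_list (map x w)"

lemma ev_simps [simp]: "ev x [] = 1" "ev x (i # w) = x i * ev x w" "ev x (v @ w) = ev x v * ev x w"
  by (simp_all add: ev_def)

lemma ev_concat: "ev x (concat us) = prod_list (map (ev x) us)"
  by (induction us) auto

lemma ev_concat_replicate: "ev x (concat (replicate k u)) = ev x u ^ k"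
  by (induction k) auto

lemma lin_ev: "(\<And>i. i \<in> set w \<Longrightarrow> lin (x i)) \<Longrightarrow> lin (ev x w)"
  unfolding ev_def by (rule lin_prod_list) auto

definition reducible :: "(nat list \<times> nat list) set \<Rightarrow> nat set \<Rightarrow> (nat \<Rightarrow> 'a) \<Rightarrow> nat list \<Rightarrow> bool" where
  "reducible R I x w \<longleftrightarrow> ev x w \<in> span (ev x ` {v \<in> lists I. (v, w) \<in> R})"

end

text \<open>Covers the two orders in use: \<open>lenlex less_than\<close>, where shorter words are
  smaller, and \<open>lex less_than\<close>, which relates only words of equal length.\<close>

definition admissible :: "(nat list \<times> nat list) set \<Rightarrow> bool" where
  "admissible R \<longleftrightarrow> wf R \<and> lex less_than \<subseteq> R \<and> (\<forall>u v a b. (u, v) \<in> R \<longrightarrow> (a @ u @ b, a @ v @ b) \<in> R)"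

lemma lex_length_eq: "(u, v) \<in> lex r \<Longrightarrow> length u = length v"
  by (simp add: lex_conv)

lemma lex_append_context: "(u, v) \<in> lex r \<Longrightarrow> (a @ u @ b, a @ v @ b) \<in> lex r"
  by (intro lex_append_leftI lex_append_rightI) auto

lemma admissible_lex: "admissible (lex less_than)"
  unfolding admissible_def by (auto intro: lex_append_context simp del: less_than_iff)

lemma admissible_lenlex: "admissible (lenlex less_than)"
  unfolding admissible_def
proof (intro conjI allI impI)
  show "wf (lenlex less_than)" by (intro wf_lenlex wf_less_than)
  show "lex less_than \<subseteq> lenlex less_than"
    by (auto simp: lenlex_conv dest: lex_length_eq simp del: less_than_iff)
next
  fix u v a b :: "nat list"
  assume "(u, v) \<in> lenlex less_than"
  then show "(a @ u @ b, a @ v @ b) \<in> lenlex less_than"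
    by (auto simp: lenlex_conv intro: lex_append_context simp del: less_than_iff)
qed

text \<open>At the first \<open>i\<close> with \<open>u ! i \<noteq> i\<close> the smaller indices
  are used up, so \<open>u ! i > i\<close>. Up to there the concatenations agree; then
  \<open>cs ! (u ! i)\<close> faces the larger \<open>cs ! i\<close>, and as both have the same
  length the comparison is decided there.\<close>

lemma permuted_concat_lex:
  assumes us: "length us = n" "length cs = n" "list_all2 prefix cs us"
    and cs: "sorted_wrt (\<lambda>x y. (y, x) \<in> lex less_than) cs" "\<forall>c\<in>set cs. length c = l"
    and u: "u \<in> permutations_of_set {..<n}" "u \<noteq> [0..<n]"
  shows "(concat (map ((!) us) u), concat us) \<in> lex less_than"
proof -
  have setu: "set u = {..<n}" and dist: "distinct u"
    using u(1) by (auto simp: permutations_of_set_def)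
  have lenu: "length u = n" using distinct_card[OF dist] setu by simp
  have "\<exists>i. i < n \<and> u ! i \<noteq> i \<and> (\<forall>j<i. u ! j = j)"
  proof -
    have "\<exists>i. i < n \<and> u ! i \<noteq> i"
    proof (rule ccontr)
      assume "\<not> ?thesis"
      then have "u = [0..<n]" by (intro nth_equalityI) (simp_all add: lenu)
      with u(2) show False by blast
    qed
    then obtain i where "i < n \<and> u ! i \<noteq> i" "\<forall>j<i. \<not> (j < n \<and> u ! j \<noteq> j)"
      unfolding exists_least_iff[of "\<lambda>i. i < n \<and> u ! i \<noteq> i"] by blast
    then show ?thesis by (intro exI[of _ i]) auto
  qed
  then obtain i where i: "i < n" "u ! i \<noteq> i" "\<And>j. j < i \<Longrightarrow> u ! j = j" by blast
  let ?j = "u ! i"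
  have j: "?j < n" using nth_mem[of i u] setu i(1) lenu by simp
  have "i < ?j"
  proof (rule ccontr)
    assume "\<not> i < ?j"
    with i(2) have "?j < i" by simp
    then have "u ! ?j = u ! i" by (rule i(3))
    then have "?j = i" using nth_eq_iff_index_eq[OF dist, of ?j i] j i(1) lenu by blast
    with i(2) show False by blast
  qed
  then have lt: "(cs ! ?j, cs ! i) \<in> lex less_than"
    using sorted_wrt_nth_less[OF cs(1) \<open>i < ?j\<close>] j us(2) by simp
  have "prefix (cs ! k) (us ! k)" if "k < n" for k
    using us(2,3) that by (simp add: list_all2_conv_all_nth)
  then obtain s t where st: "us ! i = cs ! i @ s" "us ! ?j = cs ! ?j @ t"
    using i(1) j unfolding prefix_def by metis
  have "map ((!) us) u = map ((!) us) (take i u) @ us ! ?j # map ((!) us) (drop (Suc i) u)"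
    using arg_cong[OF id_take_nth_drop[of i u], of "map ((!) us)"] i(1) lenu by simp
  moreover have "map ((!) us) (take i u) = take i us"
    by (rule nth_equalityI) (use i lenu us(1) in auto)
  ultimately obtain p where p: "concat (map ((!) us) u) = concat (take i us) @ cs ! ?j @ p"
    using st by simp
  have "us = take i us @ us ! i # drop (Suc i) us" using i(1) us(1) by (intro id_take_nth_drop) simp
  from arg_cong[OF this, of concat]
  have "concat us = concat (take i us) @ us ! i @ concat (drop (Suc i) us)"
    by (subst (asm) concat_append) (subst (asm) concat.simps, assumption)
  then have "concat us = concat (take i us) @ cs ! i @ (s @ concat (drop (Suc i) us))"
    unfolding st(1) append_assoc .
  then obtain p' where p': "concat us = concat (take i us) @ cs ! i @ p'" by blast
  \<comment> \<open>\<open>lex\<close> relates only words of equal length, so the total lengths must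
    be shown equal; permuting the blocks preserves them.\<close>
  have "mset u = mset [0..<n]"
    unfolding set_eq_iff_mset_eq_distinct[OF dist distinct_upt, symmetric] setu
    by (simp add: lessThan_atLeast0)
  then have "mset (map length (map ((!) us) u)) = mset (map length (map ((!) us) [0..<n]))"
    by (simp only: mset_map)
  also have "map ((!) us) [0..<n] = us" using map_nth[of us] us(1) by simp
  finally have "sum_mset (mset (map length (map ((!) us) u))) = sum_mset (mset (map length us))"
    by (rule arg_cong)
  then have "length (concat (map ((!) us) u)) = length (concat us)"
    by (simp only: length_concat sum_mset_sum_list)
  then have "length p = length p'" unfolding p p' using lex_length_eq[OF lt] by simp
  then show ?thesis unfolding p p' by (intro lex_append_leftI lex_append_rightI lt) simp
qed

context right_algebra
begin

text \<open>Recording that every word reached lies below \<open>w\<close> matters for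
  \<open>lex less_than\<close>: then only words of the same length as \<open>w\<close> can
  occur.\<close>

lemma in_span_irreducible:
  assumes R: "admissible R" and w: "w \<in> lists I"
  shows "ev x w \<in> span (ev x ` {v \<in> lists I. \<not> reducible R I x v \<and> (v, w) \<in> R\<^sup>*})"
proof -
  have "wf R" using R by (simp add: admissible_def)
  then show ?thesis using w
  proof (induction w rule: wf_induct_rule)
    case (less w)
    let ?S = "\<lambda>w. span (ev x ` {v \<in> lists I. \<not> reducible R I x v \<and> (v, w) \<in> R\<^sup>*})"
    show ?case
    proof (cases "reducible R I x w")
      case False
      with less show ?thesis by (intro span_base) auto
    next
      case True
      have "ev x v \<in> ?S w" if "v \<in> lists I" "(v, w) \<in> R" for v
      proof -
        have "ev x v \<in> ?S v" using less that by blast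
        moreover have "?S v \<subseteq> ?S w"
          by (intro span_mono image_mono) (use that in \<open>auto intro: rtrancl_into_rtrancl\<close>)
        ultimately show ?thesis by blast
      qed
      then have "span (ev x ` {v \<in> lists I. (v, w) \<in> R}) \<subseteq> ?S w"
        by (intro span_minimal) auto
      with True show ?thesis unfolding reducible_def by blast
      qed
qed
qed

text \<open>A rewriting rule multiplied by words on both sides is again a rule, so the irreducible
  words form a factorial language.\<close>

lemma reducible_factor:
  assumes R: "admissible R" and lin: "\<And>i. i \<in> I \<Longrightarrow> lin (x i)"
    and r: "reducible R I x v" and w: "a @ v @ b \<in> lists I"
  shows "reducible R I x (a @ v @ b)"
proof -
  let ?Z = "ev x ` {u \<in> lists I. (u, a @ v @ b) \<in> R}"
  have lb: "lin (ev x b)" by (rule lin_ev) (use w lin in auto)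
  have "ev x v * ev x b \<in> span (ev x ` {u @ b |u. u \<in> lists I \<and> (u, v) \<in> R})"
    by (rule span_mult_right[OF r[unfolded reducible_def] lb])
      (auto intro!: span_base image_eqI[where f = "ev x"])
  then have "ev x a * (ev x v * ev x b) \<in> span ?Z"
  proof (rule span_mult_left)
    fix y assume "y \<in> ev x ` {u @ b |u. u \<in> lists I \<and> (u, v) \<in> R}"
    then obtain u where u: "y = ev x (u @ b)" "u \<in> lists I" "(u, v) \<in> R" by blast
    have "a @ u @ b \<in> {u \<in> lists I. (u, a @ v @ b) \<in> R}"
      using u w R unfolding admissible_def by auto
    then have "ev x (a @ u @ b) \<in> ?Z" by (rule imageI)
    then show "ev x a * y \<in> span ?Z" unfolding u(1) by (intro span_base) simp
  qed
  then show ?thesis unfolding reducible_def by simp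
qed

text \<open>With the blocks substituted into the identity, the term of the identity permutation is
  the given word. Dividing by its coefficient expresses it by permuted concatenations, which are all
  smaller.\<close>

lemma divided_word_reducible:
  assumes R: "admissible R" and id: "multilinear_identity n q A"
    and A: "\<And>w. w \<in> lists I \<Longrightarrow> ev x w \<in> A"
    and us: "length cs = n" "list_all2 prefix cs us"
    and cs: "sorted_wrt (\<lambda>x y. (y, x) \<in> lex less_than) cs" "\<forall>c\<in>set cs. length c = l"
    and I: "concat us \<in> lists I"
  shows "reducible R I x (concat us)"
proof -
  let ?P = "permutations_of_set {..<n}"
  have lus: "length us = n" using us list_all2_lengthD by metis
  have usI: "u \<in> lists I" if "u \<in> set us" for u using I that by auto
  define y where "y i = (if i < n then ev x (us ! i) else 1)" for i
  have "y i \<in> A" for i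
    using A[OF usI] A[of "[]"] lus unfolding y_def by auto
  then have sum0: "(\<Sum>u\<in>?P. smul (q u) (prod_list (map y u))) = 0" and q: "q [0..<n] \<noteq> 0"
    using id unfolding multilinear_identity_def by auto
  have yu: "prod_list (map y u) = ev x (concat (map ((!) us) u))" if "u \<in> ?P" for u
  proof -
    have "map y u = map (ev x) (map ((!) us) u)"
      using that unfolding y_def by (auto simp: permutations_of_set_def)
    then show ?thesis by (simp only: ev_concat)
  qed
  have idP: "[0..<n] \<in> ?P" by (auto simp: permutations_of_set_def)
  have "map ((!) us) [0..<n] = us" using map_nth[of us] lus by simp
  then have "smul (q [0..<n]) (ev x (concat us)) = smul (q [0..<n]) (prod_list (map y [0..<n]))"
    using yu[OF idP] by simp
  also have "\<dots> = - (\<Sum>u\<in>?P - {[0..<n]}. smul (q u) (prod_list (map y u)))"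
    using sum0 sum.remove[OF _ idP, of "\<lambda>u. smul (q u) (prod_list (map y u))"]
    by (simp add: eq_neg_iff_add_eq_0)
  also have "\<dots> \<in> span (ev x ` {v \<in> lists I. (v, concat us) \<in> R})"
  proof (intro span_neg span_sum span_scale span_base)
    fix u assume u: "u \<in> ?P - {[0..<n]}"
    then have "(concat (map ((!) us) u), concat us) \<in> R"
      using permuted_concat_lex[OF lus us cs] R unfolding admissible_def by blast
    moreover have "concat (map ((!) us) u) \<in> lists I"
      using u I lus by (fastforce simp: permutations_of_set_def)
    ultimately show "prod_list (map y u) \<in> ev x ` {v \<in> lists I. (v, concat us) \<in> R}"
      using yu u by blast
  qed
  finally show ?thesis
    unfolding reducible_def using q span_scale[of "smul (q [0..<n]) (ev x (concat us))" _ "inverse (q [0..<n])"]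
    by simp
qed

text \<open>Infinitely many irreducible words would, by Shirshov's alternative, include one that
  splits into decreasing blocks or is a high power of a short word; both kinds are
  reducible.\<close>

theorem finite_irreducible:
  assumes R: "admissible R" and lin: "\<And>i. i \<in> I \<Longrightarrow> lin (x i)" and I: "finite I"
    and id: "multilinear_identity n q A" and A: "\<And>w. w \<in> lists I \<Longrightarrow> ev x w \<in> A"
    and pow: "\<And>u. u \<in> lists I \<Longrightarrow> u \<noteq> [] \<Longrightarrow> \<exists>k. reducible R I x (concat (replicate k u))"
  shows "finite {w \<in> lists I. \<not> reducible R I x w}"
proof (rule ccontr)
  let ?F = "{w \<in> lists I. \<not> reducible R I x w}"
  assume inf: "infinite ?F"
  have fc: "factor_closed ?F"
    unfolding factor_closed_def
  proof (intro ballI allI impI)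
    fix v w assume v: "v \<in> ?F" and "sublist w v"
    then obtain a b where ab: "v = a @ w @ b" unfolding sublist_def by blast
    have "\<not> reducible R I x w"
    proof
      assume red: "reducible R I x w"
      have "reducible R I x (a @ w @ b)"
        by (rule reducible_factor[where I = I and x = x, OF R lin red]) (use v ab in simp_all)
      with v ab show False by simp
    qed
    with v ab show "w \<in> ?F" by auto
  qed
  from pow have "\<forall>u\<in>lists I - {[]}. \<exists>k. reducible R I x (concat (replicate k u))" by blast
  from bchoice[OF this]
  obtain k where k: "\<And>u. u \<in> lists I \<Longrightarrow> u \<noteq> [] \<Longrightarrow> reducible R I x (concat (replicate (k u) u))"
    by blast
  let ?U = "{u. set u \<subseteq> I \<and> length u \<le> n}"
  \<comment> \<open>Only finitely many words have length at most \<open>n\<close>, so one exponent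
    serves them all. The \<open>Suc\<close> makes it positive, so that \<open>u\<close> itself is
    seen to be a word over \<open>I\<close>.\<close>
  define K where "K = Suc (Max (insert 0 (k ` ?U)))"
  have finU: "finite ?U" by (rule finite_lists_length_le[OF I])
  have kK: "k u \<le> K" if "u \<in> ?U" for u
    unfolding K_def using that finU by (intro le_SucI Max_ge) auto
  have "?F \<subseteq> lists I" by blast
  from shirshov_words[OF this I inf fc, of n K] show False
  proof (elim disjE exE conjE)
    fix l cs us assume "length cs = n" "sorted_wrt (\<lambda>x y. (y, x) \<in> lex less_than) cs"
      "list_all2 prefix cs us" "\<forall>c\<in>set cs. length c = l" "concat us \<in> ?F"
    then show False using divided_word_reducible[OF R id A] by blast
  next
    fix u assume u: "u \<noteq> []" "length u \<le> n" "concat (replicate K u) \<in> ?F"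
    then have uI: "u \<in> lists I" by (auto simp: K_def)
    then have "k u \<le> K" using kK u(2) by auto
    then have "concat (replicate K u) = concat (replicate (k u) u) @ concat (replicate (K - k u) u)"
      by (metis concat_append le_add_diff_inverse replicate_add)
    with u(3) have "concat (replicate (k u) u) \<in> ?F"
      using factor_closedD[OF fc u(3) prefix_imp_sublist[OF prefixI]] by blast
    with k[OF uI u(1)] show False by blast
  qed
qed

end

section \<open>Spans of unipotent monoids in finite dimension\<close>

no_notation vec_index (infixl "$" 100)
unbundle fps_syntax

section \<open>Formal power series modulo powers of the variable\<close>

definition fps_monom :: "nat \<Rightarrow> 'a \<Rightarrow> 'a::zero fps" where
  "fps_monom l a = Abs_fps (\<lambda>k. if k = l then a else 0)"

lemma fps_monom_nth [simp]: "fps_monom l a $ k = (if k = l then a else 0)"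
  by (simp add: fps_monom_def)

lemma fps_monom_mult: "fps_monom l a * fps_monom l' b = fps_monom (l + l') (a * b :: 'a::semiring_0)"
proof (rule fps_ext)
  fix k
  have "(fps_monom l a * fps_monom l' b) $ k = (\<Sum>i=0..k. if i = l then (if k - i = l' then a * b else 0) else 0)"
    unfolding fps_mult_nth by (intro sum.cong) auto
  also have "\<dots> = fps_monom (l + l') (a * b) $ k" by (auto simp: sum.delta)
  finally show "(fps_monom l a * fps_monom l' b) $ k = fps_monom (l + l') (a * b) $ k" .
qed

text \<open>Congruence modulo the \<open>N\<close>-th power of the variable. It replaces
  convergence: the infinite product is cut off at each order.\<close>

definition fps_agree :: "nat \<Rightarrow> 'a fps \<Rightarrow> 'a fps \<Rightarrow> bool" where
  "fps_agree N f g \<longleftrightarrow> (\<forall>k<N. f $ k = g $ k)"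

lemma fps_agree_refl [simp]: "fps_agree N f f"
  by (simp add: fps_agree_def)

lemma fps_agree_sym: "fps_agree N f g \<Longrightarrow> fps_agree N g f"
  by (simp add: fps_agree_def)

lemma fps_agree_trans [trans]: "fps_agree N f g \<Longrightarrow> fps_agree N g h \<Longrightarrow> fps_agree N f h"
  by (simp add: fps_agree_def)

lemma fps_agree_mult:
  fixes f g :: "'a::semiring_0 fps"
  shows "fps_agree N f f' \<Longrightarrow> fps_agree N g g' \<Longrightarrow> fps_agree N (f * g) (f' * g')"
  unfolding fps_agree_def fps_mult_nth by (auto intro!: sum.cong)

lemma fps_agree_diff:
  fixes f g :: "'a::ab_group_add fps"
  shows "fps_agree N f f' \<Longrightarrow> fps_agree N g g' \<Longrightarrow> fps_agree N (f - g) (f' - g')"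
  by (simp add: fps_agree_def)

lemma fps_agree_sum:
  fixes f :: "'b \<Rightarrow> 'a::comm_monoid_add fps"
  shows "(\<And>i. i \<in> I \<Longrightarrow> fps_agree N (f i) (g i)) \<Longrightarrow> fps_agree N (sum f I) (sum g I)"
  unfolding fps_agree_def by (auto simp: fps_sum_nth intro!: sum.cong)

lemma fps_agree_prod:
  fixes f :: "'b \<Rightarrow> 'a::comm_semiring_1 fps"
  shows "(\<And>i. i \<in> I \<Longrightarrow> fps_agree N (f i) (g i)) \<Longrightarrow> fps_agree N (prod f I) (prod g I)"
  by (induction I rule: infinite_finite_induct) (auto intro: fps_agree_mult)

lemma fps_agree_power:
  fixes f :: "'a::comm_semiring_1 fps"
  shows "fps_agree N f g \<Longrightarrow> fps_agree N (f ^ n) (g ^ n)"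
  by (induction n) (auto intro: fps_agree_mult)

lemma fps_agree_det:
  fixes C C' :: "'a::comm_ring_1 fps mat"
  assumes "C \<in> carrier_mat d d" "C' \<in> carrier_mat d d"
    and "\<And>i j. i < d \<Longrightarrow> j < d \<Longrightarrow> fps_agree N (C $$ (i, j)) (C' $$ (i, j))"
  shows "fps_agree N (det C) (det C')"
  unfolding det_def'[OF assms(1)] det_def'[OF assms(2)]
  by (intro fps_agree_sum fps_agree_mult fps_agree_prod assms(3) fps_agree_refl)
    (auto dest: permutes_in_image[of _ "{0..<d}"])

lemma fps_eqI_agree: "(\<And>N. fps_agree N f g) \<Longrightarrow> f = g"
  by (rule fps_ext) (auto simp: fps_agree_def)

lemma one_minus_mult_mat:
  fixes C D :: "'a::comm_ring_1 mat"
  assumes "C \<in> carrier_mat d d" "D \<in> carrier_mat d d"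
  shows "(1\<^sub>m d - C) * (1\<^sub>m d - D) = 1\<^sub>m d - (C + D - C * D)"
proof -
  have "(1\<^sub>m d - C) * (1\<^sub>m d - D) = 1\<^sub>m d * (1\<^sub>m d - D) - C * (1\<^sub>m d - D)"
    by (rule minus_mult_distrib_mat) (use assms in auto)
  also have "C * (1\<^sub>m d - D) = C * 1\<^sub>m d - C * D"
    by (rule mult_minus_distrib_mat) (use assms in auto)
  finally show ?thesis using assms by (intro eq_matI) auto
qed

locale matrix_representation = right_algebra smul
  for smul :: "'k::field \<Rightarrow> 'a::{ring,monoid_mult} \<Rightarrow> 'a" +
  fixes A :: "'a set" and d :: nat and me :: "'a \<Rightarrow> nat \<Rightarrow> nat \<Rightarrow> 'k"
  assumes A_1: "1 \<in> A" and A_add: "a \<in> A \<Longrightarrow> b \<in> A \<Longrightarrow> a + b \<in> A"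
    and A_smul: "a \<in> A \<Longrightarrow> smul c a \<in> A" and A_mult: "a \<in> A \<Longrightarrow> b \<in> A \<Longrightarrow> a * b \<in> A"
    and me_1: "i < d \<Longrightarrow> j < d \<Longrightarrow> me 1 i j = (if i = j then 1 else 0)"
    and me_add: "a \<in> A \<Longrightarrow> b \<in> A \<Longrightarrow> me (a + b) i j = me a i j + me b i j"
    and me_smul: "a \<in> A \<Longrightarrow> me (smul c a) i j = c * me a i j"
    and me_mult: "a \<in> A \<Longrightarrow> b \<in> A \<Longrightarrow> i < d \<Longrightarrow> l < d \<Longrightarrow> me (a * b) i l = (\<Sum>j<d. me a i j * me b j l)"
    and me_eq_0: "a \<in> A \<Longrightarrow> (\<And>i j. i < d \<Longrightarrow> j < d \<Longrightarrow> me a i j = 0) \<Longrightarrow> a = 0"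
begin

lemma A_0: "0 \<in> A" using A_smul[OF A_1, of 0] by simp
lemma A_uminus: "a \<in> A \<Longrightarrow> - a \<in> A" using A_smul[of a "-1"] by simp
lemma A_diff: "a \<in> A \<Longrightarrow> b \<in> A \<Longrightarrow> a - b \<in> A" using A_add[of a "- b"] A_uminus by simp
lemma A_sum: "(\<And>i. i \<in> I \<Longrightarrow> f i \<in> A) \<Longrightarrow> sum f I \<in> A"
  by (induction I rule: infinite_finite_induct) (auto intro: A_0 A_add)
lemma A_power: "a \<in> A \<Longrightarrow> a ^ k \<in> A"
  by (induction k) (auto intro: A_1 A_mult)

lemma me_0: "me 0 i j = 0" using me_smul[OF A_1, of 0] by simp
lemma me_uminus: "a \<in> A \<Longrightarrow> me (- a) i j = - me a i j" using me_smul[of a "-1"] by simp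
lemma me_diff: "a \<in> A \<Longrightarrow> b \<in> A \<Longrightarrow> me (a - b) i j = me a i j - me b i j"
  using me_add[of a "- b"] A_uminus me_uminus by simp
lemma me_sum: "(\<And>i. i \<in> I \<Longrightarrow> f i \<in> A) \<Longrightarrow> me (sum f I) i j = (\<Sum>k\<in>I. me (f k) i j)"
proof (induction I rule: infinite_finite_induct)
  case (insert x F)
  then show ?case using me_add[of "f x" "sum f F"] A_sum[of F f] by simp
qed (auto simp: me_0)

section \<open>Determinants of one minus a power series over the algebra\<close>

definition A_fps :: "'a fps set" where "A_fps = {f. \<forall>k. f $ k \<in> A}"

lemma A_fps_0: "0 \<in> A_fps" by (simp add: A_fps_def A_0)
lemma A_fps_add: "f \<in> A_fps \<Longrightarrow> g \<in> A_fps \<Longrightarrow> f + g \<in> A_fps" by (simp add: A_fps_def A_add)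
lemma A_fps_mult: "f \<in> A_fps \<Longrightarrow> g \<in> A_fps \<Longrightarrow> f * g \<in> A_fps"
  by (auto simp: A_fps_def fps_mult_nth intro!: A_sum A_mult)
lemma A_fps_monom: "a \<in> A \<Longrightarrow> fps_monom l a \<in> A_fps" by (simp add: A_fps_def A_0)

definition Mt :: "'a fps \<Rightarrow> 'k fps mat" where
  "Mt f = mat d d (\<lambda>(i, j). Abs_fps (\<lambda>k. me (f $ k) i j))"

lemma Mt_carrier [simp]: "Mt f \<in> carrier_mat d d" by (simp add: Mt_def)
lemma Mt_dim [simp]: "dim_row (Mt f) = d" "dim_col (Mt f) = d" by (simp_all add: Mt_def)
lemma Mt_nth: "i < d \<Longrightarrow> j < d \<Longrightarrow> Mt f $$ (i, j) $ k = me (f $ k) i j" by (simp add: Mt_def)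

lemma Mt_add: "f \<in> A_fps \<Longrightarrow> g \<in> A_fps \<Longrightarrow> Mt (f + g) = Mt f + Mt g"
  by (rule eq_matI) (auto simp: A_fps_def me_add Mt_nth intro!: fps_ext)

lemma Mt_diff: "f \<in> A_fps \<Longrightarrow> g \<in> A_fps \<Longrightarrow> Mt (f - g) = Mt f - Mt g"
  by (rule eq_matI) (auto simp: A_fps_def me_diff Mt_nth intro!: fps_ext)

lemma Mt_mult:
  assumes f: "f \<in> A_fps" and g: "g \<in> A_fps"
  shows "Mt (f * g) = Mt f * Mt g"
proof (rule eq_matI, goal_cases)
  case (1 i l)
  then have il: "i < d" "l < d" by auto
  have "Mt (f * g) $$ (i, l) $ k = (Mt f * Mt g) $$ (i, l) $ k" for k
  proof -
    have "Mt (f * g) $$ (i, l) $ k = (\<Sum>s=0..k. me (f $ s * g $ (k - s)) i l)"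
      unfolding Mt_nth[OF il] fps_mult_nth using f g by (intro me_sum A_mult) (auto simp: A_fps_def)
    also have "\<dots> = (\<Sum>s=0..k. \<Sum>j<d. me (f $ s) i j * me (g $ (k - s)) j l)"
      using f g il by (intro sum.cong me_mult) (auto simp: A_fps_def)
    also have "\<dots> = (\<Sum>j<d. \<Sum>s=0..k. Mt f $$ (i, j) $ s * Mt g $$ (j, l) $ (k - s))"
      using il by (subst sum.swap) (auto simp: Mt_nth)
    also have "\<dots> = (\<Sum>j<d. Mt f $$ (i, j) * Mt g $$ (j, l)) $ k"
      by (simp add: fps_sum_nth fps_mult_nth)
    also have "(\<Sum>j<d. Mt f $$ (i, j) * Mt g $$ (j, l)) = (Mt f * Mt g) $$ (i, l)"
      using il by (simp add: scalar_prod_def lessThan_atLeast0)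
    finally show ?thesis .
  qed
  then show ?case by (rule fps_ext)
qed auto

text \<open>As a function of \<open>f\<close> it is multiplicative for the circle operation
  \<open>f + g - f * g\<close>, which corresponds to multiplying \<open>1 - f\<close> by
  \<open>1 - g\<close>.\<close>

definition qdet :: "'a fps \<Rightarrow> 'k fps" where "qdet f = det (1\<^sub>m d - Mt f)"

lemma qdet_mult:
  assumes "f \<in> A_fps" "g \<in> A_fps"
  shows "qdet f * qdet g = qdet (f + g - f * g)"
proof -
  have "qdet f * qdet g = det ((1\<^sub>m d - Mt f) * (1\<^sub>m d - Mt g))"
    unfolding qdet_def by (rule det_mult[symmetric]) (auto intro: minus_carrier_mat)
  also have "(1\<^sub>m d - Mt f) * (1\<^sub>m d - Mt g) = 1\<^sub>m d - Mt (f + g - f * g)"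
    using assms by (simp add: one_minus_mult_mat Mt_diff Mt_add Mt_mult A_fps_add A_fps_mult)
  finally show ?thesis by (simp add: qdet_def)
qed

lemma qdet_agree:
  assumes "fps_agree N f g"
  shows "fps_agree N (qdet f) (qdet g)"
  unfolding qdet_def
proof (rule fps_agree_det)
  fix i j assume "i < d" "j < d"
  then show "fps_agree N ((1\<^sub>m d - Mt f) $$ (i, j)) ((1\<^sub>m d - Mt g) $$ (i, j))"
    using assms by (auto simp: fps_agree_def Mt_nth)
qed (auto intro: minus_carrier_mat)

lemma qdet_0: "qdet 0 = 1"
proof -
  have "1\<^sub>m d - Mt 0 = 1\<^sub>m d" by (rule eq_matI) (auto intro!: fps_ext simp: Mt_nth me_0)
  then show ?thesis by (simp add: qdet_def)
qed

text \<open>The matrix of \<open>t^l a\<close> over polynomials. There a unit is constant, whereas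
  every power series with nonzero constant term is a unit, so invertibility of the determinant is
  informative only here.\<close>

definition Mp :: "nat \<Rightarrow> 'a \<Rightarrow> 'k poly mat" where
  "Mp l a = mat d d (\<lambda>(i, j). monom (me a i j) l)"

lemma Mp_carrier [simp]: "Mp l a \<in> carrier_mat d d" by (simp add: Mp_def)

lemma Mp_mult: "a \<in> A \<Longrightarrow> b \<in> A \<Longrightarrow> Mp l a * Mp l' b = Mp (l + l') (a * b)"
  by (rule eq_matI) (auto simp: Mp_def scalar_prod_def me_mult mult_monom monom_sum lessThan_atLeast0)

lemma Mp_uminus: "a \<in> A \<Longrightarrow> Mp l (- a) = - Mp l a"
  by (rule eq_matI) (auto simp: Mp_def me_uminus minus_monom)

text \<open>Uses \<open>(1 - a)(1 + a) = 1 - a\<^sup>2\<close> to halve the nilpotency index.\<close>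

lemma det_poly_nilpotent_unit:
  assumes "a \<in> A" "a ^ (2 ^ k) = 0"
  shows "is_unit (det (1\<^sub>m d - Mp l a))"
  using assms
proof (induction k arbitrary: a l)
  case 0
  then have "Mp l a = 0\<^sub>m d d" by (auto simp: Mp_def me_0)
  then have "1\<^sub>m d - Mp l a = 1\<^sub>m d" by auto
  then show ?case by simp
next
  case (Suc k)
  have "(a * a) ^ (2 ^ k) = 0"
    using Suc.prems(2) by (simp add: power_mult[symmetric] power2_eq_square[symmetric] power_even_eq)
  then have unit: "is_unit (det (1\<^sub>m d - Mp (l + l) (a * a)))"
    using Suc.IH[of "a * a"] A_mult Suc.prems(1) by blast
  have "Mp l a * Mp l (- a) = - Mp (l + l) (a * a)"
    using Mp_mult[OF Suc.prems(1) A_uminus[OF Suc.prems(1)]] Mp_uminus[OF A_mult[OF Suc.prems(1,1)]] by simp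
  then have "Mp l a + Mp l (- a) - Mp l a * Mp l (- a) = Mp (l + l) (a * a)"
    using Suc.prems(1) by (intro eq_matI) (auto simp: Mp_uminus Mp_def me_uminus add_monom)
  then have "(1\<^sub>m d - Mp l a) * (1\<^sub>m d - Mp l (- a)) = 1\<^sub>m d - Mp (l + l) (a * a)"
    by (simp add: one_minus_mult_mat)
  then have "det (1\<^sub>m d - Mp l a) * det (1\<^sub>m d - Mp l (- a)) = det (1\<^sub>m d - Mp (l + l) (a * a))"
    using det_mult[of "1\<^sub>m d - Mp l a" d "1\<^sub>m d - Mp l (- a)"] by (simp add: minus_carrier_mat)
  with unit show ?case by (metis dvd_triv_left dvd_trans)
qed

text \<open>A unit of the polynomial ring over a field is constant, and at 0 the matrix is the
  identity.\<close>

lemma det_poly_nilpotent: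
  assumes "a \<in> A" "a ^ k = 0"
  shows "det (1\<^sub>m d - Mp 1 a) = 1"
proof -
  have "a ^ (2 ^ k) = a ^ k * a ^ (2 ^ k - k)"
    by (simp add: power_add[symmetric] less_imp_le)
  then have "is_unit (det (1\<^sub>m d - Mp 1 a))"
    using det_poly_nilpotent_unit[OF assms(1), of k 1] assms(2) by simp
  then obtain c where c: "det (1\<^sub>m d - Mp 1 a) = [:c:]" by (auto simp: is_unit_poly_iff)
  interpret ev0: comm_ring_hom "\<lambda>p :: 'k poly. poly p 0" by unfold_locales auto
  have "map_mat (\<lambda>p. poly p 0) (1\<^sub>m d - Mp 1 a) = 1\<^sub>m d"
    by (rule eq_matI) (auto simp: Mp_def poly_monom)
  then have "poly (det (1\<^sub>m d - Mp 1 a)) 0 = 1"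
    by (metis ev0.hom_det det_one)
  with c show ?thesis by (simp add: one_pCons)
qed

text \<open>Substituting \<open>u\<close> for the variable is a ring homomorphism because
  \<open>u\<close> has no constant term; it is applied to the polynomial case.\<close>

lemma det_fps_nilpotent:
  assumes a: "a \<in> A" "a ^ k = 0" and u: "u $ 0 = 0"
  shows "det (mat d d (\<lambda>(i, j). (if i = j then 1 else 0) - fps_const (me a i j) * u)) = 1"
proof -
  let ?h = "\<lambda>p :: 'k poly. fps_compose (fps_of_poly p) u"
  interpret h: comm_ring_hom ?h
    by unfold_locales (auto simp: fps_of_poly_mult fps_compose_mult_distrib[OF u] fps_of_poly_add fps_compose_add_distrib)
  have "map_mat ?h (1\<^sub>m d - Mp 1 a) = mat d d (\<lambda>(i, j). (if i = j then 1 else 0) - fps_const (me a i j) * u)"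
    by (rule eq_matI)
      (auto simp: Mp_def fps_of_poly_diff fps_compose_sub_distrib fps_of_poly_monom
         fps_compose_mult_distrib[OF u] u fps_compose_uminus)
  moreover have "det (map_mat ?h (1\<^sub>m d - Mp 1 a)) = 1"
    by (simp only: h.hom_det det_poly_nilpotent[OF a] h.hom_one)
  ultimately show ?thesis by simp
qed

text \<open>With \<open>s\<close> the scalar monomial,
  \<open>1 - s h = (1 - s) (1 - u (h - 1))\<close> for \<open>u = s / (1 - s)\<close>, and the
  second factor has determinant 1. The condition \<open>l > 0\<close> makes \<open>1 - s\<close>
  invertible.\<close>

lemma qdet_unipotent_monom:
  assumes h: "h \<in> A" "(h - 1) ^ k = 0" and l: "l > 0"
  shows "qdet (fps_monom l (smul c h)) = (1 - fps_monom l c) ^ d"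
proof -
  let ?s = "fps_monom l c" and ?a = "h - 1"
  define u where "u = ?s * inverse (1 - ?s)"
  have inv: "(1 - ?s) * inverse (1 - ?s) = 1"
    using l by (intro inverse_mult_eq_1') simp
  have u0: "u $ 0 = 0" using l by (simp add: u_def)
  have a: "?a \<in> A" using h A_1 A_diff by blast
  let ?N = "mat d d (\<lambda>(i, j). (if i = j then 1 else 0) - fps_const (me ?a i j) * u)"
  have "1\<^sub>m d - Mt (fps_monom l (smul c h)) = (1 - ?s) \<cdot>\<^sub>m ?N"
  proof (rule eq_matI, goal_cases)
    case (1 i j)
    then have ij: "i < d" "j < d" by auto
    have "me h i j = me ?a i j + (if i = j then 1 else 0)"
      using me_diff[OF h(1) A_1, of i j] me_1[OF ij] by auto
    then have Mt: "Mt (fps_monom l (smul c h)) $$ (i, j) =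
        ?s * fps_const (me ?a i j) + ?s * (if i = j then 1 else 0)"
      using ij h(1) by (intro fps_ext) (auto simp: Mt_nth me_0 me_smul algebra_simps)
    have "(1 - ?s) * u = ?s" using inv by (simp add: u_def mult.left_commute)
    then have eq: "(1 - ?s) * (fps_const (me ?a i j) * u) = fps_const (me ?a i j) * ?s"
      by (metis mult.left_commute)
    have "(1 - ?s) * ((if i = j then 1 else 0) - fps_const (me ?a i j) * u) =
        (if i = j then 1 else 0) - Mt (fps_monom l (smul c h)) $$ (i, j)"
      unfolding Mt right_diff_distrib[of "1 - ?s"] eq by (simp add: algebra_simps)
    then show ?case using ij by simp
  qed auto
  then have "qdet (fps_monom l (smul c h)) = (1 - ?s) ^ d * det ?N"
    unfolding qdet_def by (simp add: det_smult)
  then show ?thesis using det_fps_nilpotent[OF a h(2) u0] by simp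
qed

text \<open>A monomial paired with its image under replacing \<open>h\<close> by 1. This replacement
  is not known to be well defined on the span of \<open>M\<close>, so the image is carried
  along.\<close>

definition letter :: "'a set \<Rightarrow> nat \<Rightarrow> 'a fps \<times> 'k fps \<Rightarrow> bool" where
  "letter M w p \<longleftrightarrow> (\<exists>c h l. h \<in> M \<and> w \<le> l \<and> p = (fps_monom l (smul c h), fps_monom l c))"

lemma letter_mono: "letter M w p \<Longrightarrow> w' \<le> w \<Longrightarrow> letter M w' p"
  unfolding letter_def using order_trans by blast

lemma letter_mult:
  assumes M: "\<And>a b. a \<in> M \<Longrightarrow> b \<in> M \<Longrightarrow> a * b \<in> M" "\<And>a. a \<in> M \<Longrightarrow> lin a"
    and p: "letter M w p" and p': "letter M w' p'"
  shows "letter M (w + w') (fst p * fst p', snd p * snd p')"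
proof -
  obtain c h l where 1: "h \<in> M" "w \<le> l" "p = (fps_monom l (smul c h), fps_monom l c)"
    using p letter_def by blast
  obtain c' h' l' where 2: "h' \<in> M" "w' \<le> l'" "p' = (fps_monom l' (smul c' h'), fps_monom l' c')"
    using p' letter_def by blast
  have "smul c h * smul c' h' = smul (c * c') (h * h')"
    by (simp add: mult_smul smul_mult[OF M(2)[OF 2(1)]] mult.commute)
  then have "(fst p * fst p', snd p * snd p') = (fps_monom (l + l') (smul (c * c') (h * h')), fps_monom (l + l') (c * c'))"
    using 1(3) 2(3) by (simp add: fps_monom_mult)
  then show ?thesis unfolding letter_def using 1 2 M(1) add_mono by blast
qed

lemma sum_letters_agree_0:
  assumes "\<forall>p\<in>set L. letter M w p" "N \<le> w"
  shows "fps_agree N (sum_list (map fst L)) 0 \<and> fps_agree N (sum_list (map snd L)) 0"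
  using assms by (induction L) (auto simp: fps_agree_def letter_def)

lemma sum_letters_A_fps:
  assumes "\<forall>p\<in>set L. letter M w p" "M \<subseteq> A"
  shows "sum_list (map fst L) \<in> A_fps"
  using assms by (induction L) (auto simp: A_fps_0 letter_def intro!: A_fps_add A_fps_monom A_smul)

text \<open>Elimination: \<open>1 - e - F = (1 - e)(1 - (F + e F + e\<^sup>2 F + \<dots>))\<close> removes the letter \<open>e\<close> of
  minimal weight and creates only letters of larger weight.\<close>

lemma qdet_letters:
  assumes M: "\<And>a b. a \<in> M \<Longrightarrow> b \<in> M \<Longrightarrow> a * b \<in> M" "\<And>a. a \<in> M \<Longrightarrow> lin a" "M \<subseteq> A"
    and unip: "\<And>a. a \<in> M \<Longrightarrow> \<exists>k. (a - 1) ^ k = 0"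
    and w: "w > 0" and xs: "\<forall>p\<in>set xs. letter M w p" and ys: "\<forall>p\<in>set ys. letter M (Suc w) p"
  shows "fps_agree N (qdet (sum_list (map fst (xs @ ys)))) ((1 - sum_list (map snd (xs @ ys))) ^ d)"
  using w xs ys
\<comment> \<open>The outer induction raises the weight up to \<open>N\<close>; the inner one
  empties \<open>xs\<close>, the only list that may still hold letters of weight exactly
  \<open>w\<close>.\<close>
proof (induction "N - w" arbitrary: w xs ys rule: less_induct)
  case (less w)
  show ?case
  proof (cases "N \<le> w")
    case True
    have all: "\<forall>p\<in>set (xs @ ys). letter M w p"
      using less.prems letter_mono[of M "Suc w" _ w] by auto
    have "fps_agree N (qdet (sum_list (map fst (xs @ ys)))) 1"
      using qdet_agree[OF conjunct1[OF sum_letters_agree_0[OF all True]]] by (simp add: qdet_0)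
    also have "fps_agree N 1 ((1 - sum_list (map snd (xs @ ys))) ^ d)"
      using fps_agree_power[OF fps_agree_diff[OF fps_agree_refl
          fps_agree_sym[OF conjunct2[OF sum_letters_agree_0[OF all True]]]], of 1 d] by simp
    finally show ?thesis .
  next
    case False
    from less.prems(2,3) show ?thesis
    proof (induction xs arbitrary: ys)
      case Nil
      then show ?case using less.hyps[of "Suc w" ys "[]"] False by simp
    next
      case (Cons p xs)
      obtain e s where p: "p = (e, s)" by (cases p)
      have pw: "letter M w (e, s)" using Cons.prems(1) p by simp
      define T where "T k = ((map (\<lambda>(f, t). (e * f, s * t))) ^^ k) (xs @ ys)" for k
      define F where "F k = sum_list (map fst (T k))" for k
      define S where "S k = sum_list (map snd (T k))" for k
      have F_Suc: "F (Suc k) = e * F k" and S_Suc: "S (Suc k) = s * S k" for k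
        unfolding F_def S_def T_def
        by (simp_all add: sum_list_const_mult[symmetric] o_def case_prod_beta)
      have T_w: "\<forall>q\<in>set (T k). letter M (k + w) q" for k
      proof (induction k)
        case 0
        show ?case using Cons.prems letter_mono[of M "Suc w" _ w] by (auto simp: T_def)
      next
        case (Suc k)
        have "letter M (w + (k + w)) (e * f, s * t)" if "(f, t) \<in> set (T k)" for f t
          using letter_mult[OF M(1,2) pw, of "k + w" "(f, t)"] Suc that by auto
        then show ?case using \<open>w > 0\<close> letter_mono[of M "w + (k + w)" _ "Suc k + w"]
          by (fastforce simp: T_def)
      qed
      \<comment> \<open>\<open>T k\<close> is the list \<open>xs @ ys\<close> multiplied by the
        \<open>k\<close>-th power of \<open>e\<close>. Each factor \<open>e\<close> adds at least
        \<open>w > 0\<close> to the weight, so these letters may join the heavier list, and beyond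
        \<open>N\<close> factors they vanish to the order considered.\<close>
      define zs where "zs = ys @ concat (map (\<lambda>k. T (Suc k)) [0..<N])"
      have zs: "\<forall>q\<in>set zs. letter M (Suc w) q"
      proof -
        have "letter M (Suc w) q" if "q \<in> set (T (Suc k))" for q k
          using T_w[of "Suc k"] that letter_mono[of M "Suc k + w" q "Suc w"] by simp
        then show ?thesis using Cons.prems(2) by (auto simp: zs_def)
      qed
      have sums: "sum_list (map fst (xs @ zs)) = (\<Sum>k\<le>N. F k)" "sum_list (map snd (xs @ zs)) = (\<Sum>k\<le>N. S k)"
      proof -
        have "sum_list (map fst (concat (map (\<lambda>k. T (Suc k)) [0..<N]))) = (\<Sum>k<N. F (Suc k))"
          "sum_list (map snd (concat (map (\<lambda>k. T (Suc k)) [0..<N]))) = (\<Sum>k<N. S (Suc k))"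
          by (induction N) (simp_all add: F_def S_def)
        moreover have "T 0 = xs @ ys" by (simp add: T_def)
        ultimately show "sum_list (map fst (xs @ zs)) = (\<Sum>k\<le>N. F k)" "sum_list (map snd (xs @ zs)) = (\<Sum>k\<le>N. S k)"
          unfolding zs_def lessThan_Suc_atMost[symmetric] sum.lessThan_Suc_shift
          by (simp_all add: F_def S_def add.assoc)
      qed
      obtain c h l where el: "h \<in> M" "w \<le> l" "e = fps_monom l (smul c h)" "s = fps_monom l c"
        using pw unfolding letter_def by blast
      obtain k where k: "(h - 1) ^ k = 0" using unip el(1) by blast
      have eA: "e \<in> A_fps" unfolding el(3) using el(1) M(3) by (intro A_fps_monom A_smul) auto
      have all: "\<forall>q\<in>set (xs @ zs). letter M w q"
        using Cons.prems(1) zs letter_mono[of M "Suc w" _ w] by auto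
      have FA: "(\<Sum>k\<le>N. F k) \<in> A_fps"
        unfolding sums(1)[symmetric] by (rule sum_letters_A_fps[OF all M(3)])
      have tel: "(\<Sum>k\<le>N. G k) - (\<Sum>k\<le>N. G (Suc k)) = G 0 - G (Suc N)" for G :: "nat \<Rightarrow> 'z::ab_group_add"
        by (induction N) (auto simp: algebra_simps)
      \<comment> \<open>The circle product of \<open>e\<close> with the truncated geometric sum
        telescopes to \<open>e + F 0\<close>, up to a term that is zero modulo the
        \<open>N\<close>-th power.\<close>
      have F_tel: "e + (\<Sum>k\<le>N. F k) - e * (\<Sum>k\<le>N. F k) = e + F 0 - F (Suc N)"
        using tel[of F] by (simp add: F_Suc sum_distrib_left add_diff_eq[symmetric])
      have S_tel: "(1 - s) * (1 - (\<Sum>k\<le>N. S k)) = 1 - (s + S 0 - S (Suc N))"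
      proof -
        have "s * (\<Sum>k\<le>N. S k) = (\<Sum>k\<le>N. S (Suc k))" by (simp add: S_Suc sum_distrib_left)
        moreover have "(1 - s) * (1 - (\<Sum>k\<le>N. S k)) = 1 - (s + ((\<Sum>k\<le>N. S k) - s * (\<Sum>k\<le>N. S k)))"
          by (simp add: algebra_simps)
        ultimately show ?thesis using tel[of S] by (simp add: add_diff_eq)
      qed
      have small: "fps_agree N (F (Suc N)) 0" "fps_agree N (S (Suc N)) 0"
        using sum_letters_agree_0[OF T_w[of "Suc N"], of N] by (simp_all add: F_def S_def)
      have "fps_agree N (qdet (e + F 0)) (qdet (e + F 0 - F (Suc N)))"
        using fps_agree_diff[OF fps_agree_refl[of N "e + F 0"] fps_agree_sym[OF small(1)]]
        by (intro qdet_agree) simp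
      also have "qdet (e + F 0 - F (Suc N)) = (1 - s) ^ d * qdet (\<Sum>k\<le>N. F k)"
        unfolding F_tel[symmetric] qdet_mult[OF eA FA, symmetric]
        using qdet_unipotent_monom[of h k l c] el k M(3) \<open>w > 0\<close> by auto
      also have "fps_agree N \<dots> ((1 - s) ^ d * (1 - (\<Sum>k\<le>N. S k)) ^ d)"
        using Cons.IH[of zs] Cons.prems(1) zs unfolding sums by (intro fps_agree_mult) auto
      also have "(1 - s) ^ d * (1 - (\<Sum>k\<le>N. S k)) ^ d = (1 - (s + S 0 - S (Suc N))) ^ d"
        by (simp only: power_mult_distrib[symmetric] S_tel)
      also have "fps_agree N \<dots> ((1 - (s + S 0)) ^ d)"
        using fps_agree_diff[OF fps_agree_refl[of N "s + S 0"] small(2)]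
        by (intro fps_agree_power fps_agree_diff) auto
      finally show ?case by (simp add: p F_def S_def T_def)
    qed
  qed
qed

text \<open>Writing \<open>a\<close> as a sum of terms \<open>c (h - 1)\<close> gives letters whose
  scalar parts cancel, so \<open>det (1 - t a) = 1\<close>. The adjugate is then a polynomial
  inverse of \<open>1 - t a\<close>; its coefficients are the powers of \<open>a\<close>, which
  vanish beyond its degree.\<close>

lemma span_unipotent_nilpotent:
  assumes M: "\<And>a b. a \<in> M \<Longrightarrow> b \<in> M \<Longrightarrow> a * b \<in> M" "\<And>a. a \<in> M \<Longrightarrow> lin a" "M \<subseteq> A" "1 \<in> M"
    and unip: "\<And>a. a \<in> M \<Longrightarrow> \<exists>k. (a - 1) ^ k = 0"
    and a: "a \<in> span ((\<lambda>h. h - 1) ` M)"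
  shows "\<exists>k. a ^ k = 0"
proof -
  have "\<exists>L. (\<forall>p\<in>set L. letter M 1 p) \<and> sum_list (map fst L) = fps_monom 1 a \<and> sum_list (map snd L) = 0"
    using a
  proof (induction rule: span_induct_alt)
    case base
    show ?case by (intro exI[of _ "[]"]) (auto intro: fps_ext)
  next
    case (step c x y)
    then obtain h L where "h \<in> M" "x = h - 1" and L: "\<forall>p\<in>set L. letter M 1 p"
      "sum_list (map fst L) = fps_monom 1 y" "sum_list (map snd L) = 0" by blast
    let ?p = "(fps_monom 1 (smul c h), fps_monom 1 c)"
      and ?q = "(fps_monom 1 (smul (- c) 1), fps_monom 1 (- c))"
    have "letter M 1 ?p" "letter M 1 ?q"
      unfolding letter_def using \<open>h \<in> M\<close> M(4) by blast+
    moreover have "sum_list (map fst (?p # ?q # L)) = fps_monom 1 (smul c x + y)"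
      "sum_list (map snd (?p # ?q # L)) = 0"
      using L(2,3) \<open>x = h - 1\<close> by (auto simp: scale_right_diff_distrib intro!: fps_ext)
    ultimately show ?case using L(1) by (intro exI[of _ "?p # ?q # L"]) simp
  qed
  then obtain L where L: "\<forall>p\<in>set L. letter M 1 p" "sum_list (map fst L) = fps_monom 1 a"
    "sum_list (map snd L) = 0" by blast
  interpret h: comm_ring_hom "fps_of_poly :: 'k poly \<Rightarrow> 'k fps"
    by unfold_locales (auto simp: fps_of_poly_mult fps_of_poly_add)
  have aA: "a \<in> A"
    using a by (induction rule: span_induct_alt) (use M(3) in \<open>auto intro!: A_0 A_1 A_add A_smul A_diff\<close>)
  have "qdet (fps_monom 1 a) = 1"
    by (rule fps_eqI_agree)
      (use qdet_letters[OF M(1-3) unip, of 1 L "[]"] L in auto)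
  moreover have "map_mat fps_of_poly (1\<^sub>m d - Mp 1 a) = 1\<^sub>m d - Mt (fps_monom 1 a)"
    by (rule eq_matI) (auto intro!: fps_ext simp: Mp_def Mt_nth me_0 coeff_diff)
  ultimately have "fps_of_poly (det (1\<^sub>m d - Mp 1 a)) = fps_of_poly 1"
    by (simp add: qdet_def h.hom_det[symmetric])
  then have det1: "det (1\<^sub>m d - Mp 1 a) = 1" unfolding fps_of_poly_eq_iff .
  have one: "1 \<cdot>\<^sub>m 1\<^sub>m d = (1\<^sub>m d :: 'k poly mat)" by (rule eq_matI) auto
  define Q where "Q = adj_mat (1\<^sub>m d - Mp 1 a)"
  have Q: "Q \<in> carrier_mat d d" "(1\<^sub>m d - Mp 1 a) * Q = 1\<^sub>m d"
    using adj_mat[of "1\<^sub>m d - Mp 1 a" d] det1 one by (simp_all add: Q_def minus_carrier_mat)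
  have "Q - Mp 1 a * Q = 1\<^sub>m d"
    using Q minus_mult_distrib_mat[of "1\<^sub>m d" d d "Mp 1 a" Q d] by simp
  then have Q_eq: "Q $$ (i, j) - (\<Sum>l<d. monom (me a i l) 1 * Q $$ (l, j)) = (if i = j then 1 else 0)"
    if "i < d" "j < d" for i j
  proof -
    have "(Q - Mp 1 a * Q) $$ (i, j) = Q $$ (i, j) - (\<Sum>l<d. monom (me a i l) 1 * Q $$ (l, j))"
      using that Q(1) by (simp add: Mp_def scalar_prod_def lessThan_atLeast0)
    with \<open>Q - Mp 1 a * Q = 1\<^sub>m d\<close> that show ?thesis by simp
  qed
  \<comment> \<open>The equation \<open>Q = 1 + t a Q\<close> determines the coefficients
    recursively: \<open>Q\<close> is the geometric series in \<open>t a\<close>.\<close>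
  have coeff_Q: "coeff (Q $$ (i, j)) k = me (a ^ k) i j" if "i < d" "j < d" for i j k
    using that
  proof (induction k arbitrary: i)
    case 0
    have "coeff (Q $$ (i, j)) 0 = coeff (if i = j then 1 else 0) 0"
      using arg_cong[OF Q_eq[OF 0], of "\<lambda>p. coeff p 0"] by (simp add: coeff_sum coeff_monom_mult)
    then show ?case using 0 by (simp add: me_1)
  next
    case (Suc k)
    have "coeff (Q $$ (i, j)) (Suc k) = (\<Sum>l<d. me a i l * coeff (Q $$ (l, j)) k)"
      using arg_cong[OF Q_eq[OF Suc.prems], of "\<lambda>p. coeff p (Suc k)"]
      by (simp add: coeff_sum coeff_monom_mult coeff_1 split: if_splits)
    also have "\<dots> = me (a ^ Suc k) i j"
      using Suc me_mult[OF aA A_power[OF aA]] by simp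
    finally show ?case .
  qed
  define n where "n = Suc (Max (insert 0 ((\<lambda>(i, j). degree (Q $$ (i, j))) ` ({..<d} \<times> {..<d}))))"
  have "degree (Q $$ (i, j)) < n" if "i < d" "j < d" for i j
    unfolding n_def using that by (intro le_imp_less_Suc Max_ge) auto
  then have "me (a ^ n) i j = 0" if "i < d" "j < d" for i j
    using coeff_eq_0[of "Q $$ (i, j)" n] that coeff_Q[of i j n] by simp
  then have "a ^ n = 0" by (rule me_eq_0[OF A_power[OF aA]])
  then show ?thesis by blast
qed

end

section \<open>Finitely generated unipotent groups\<close>

context right_algebra
begin

text \<open>Right multiplication on \<open>span M\<close>, in a basis taken from \<open>M\<close>,
  is a matrix representation because \<open>M\<close> is closed under products, and it is faithful
  because \<open>1 \<in> M\<close>.\<close>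

lemma finite_dim_unipotent_nilpotent:
  assumes M: "\<And>a b. a \<in> M \<Longrightarrow> b \<in> M \<Longrightarrow> a * b \<in> M" "\<And>a. a \<in> M \<Longrightarrow> lin a" "1 \<in> M"
    and unip: "\<And>a. a \<in> M \<Longrightarrow> \<exists>k. (a - 1) ^ k = 0"
    and fin: "finite W" "M \<subseteq> span W"
    and a: "a \<in> span ((\<lambda>h. h - 1) ` M)"
  shows "\<exists>k. a ^ k = 0"
proof -
  obtain B where B: "B \<subseteq> M" "independent B" "M \<subseteq> span B"
    by (rule maximal_independent_subset)
  have finB: "finite B"
    using independent_span_bound[OF fin(1) B(2)] B(1) fin(2) by blast
  obtain bs where bs: "set bs = B" "distinct bs" using finite_distinct_list[OF finB] by blast
  define d where "d = length bs"
  have bsB: "bs ! i \<in> B" if "i < d" for i using that bs(1) d_def nth_mem by auto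
  have bij: "bij_betw ((!) bs) {..<d} B"
    using bij_betw_nth[OF bs(2)] bs(1) d_def by simp
  define A where "A = span M"
  have AB: "A = span B" unfolding A_def
    using B(1,3) span_mono span_minimal[OF B(3)] by (simp add: subset_antisym)
  have MA: "M \<subseteq> A" unfolding A_def by (rule span_superset)
  have A_lin: "lin y" if "y \<in> A" for y using lin_span[of M y] M(2) that unfolding A_def by blast
  have A_mult: "y * z \<in> A" if "y \<in> A" "z \<in> A" for y z
    using span_mult_closed[of M y z] M that unfolding A_def by blast
  have bsA: "bs ! i * y \<in> A" if "i < d" "y \<in> A" for i y
    using A_mult[of "bs ! i" y] bsB[of i] that B(1) MA by blast
  \<comment> \<open>For \<open>i \<ge> d\<close> the element \<open>bs ! i\<close> is unspecified
    and \<open>bs ! i * y\<close> might leave the span; the default 0 keeps \<open>me\<close> linear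
    in \<open>y\<close> for all indices.\<close>
  define me where "me y i j = (if i < d then representation B (bs ! i * y) (bs ! j) else 0)" for y i j
  have expand: "bs ! i * y = (\<Sum>j<d. smul (me y i j) (bs ! j))" if "i < d" "y \<in> A" for i y
  proof -
    have "bs ! i * y = (\<Sum>b\<in>B. smul (representation B (bs ! i * y) b) b)"
      using sum_representation_eq[OF B(2) _ finB order_refl] bsA that by (simp add: AB)
    also have "\<dots> = (\<Sum>j<d. smul (representation B (bs ! i * y) (bs ! j)) (bs ! j))"
      by (rule sum.reindex_bij_betw[OF bij, symmetric])
    finally show ?thesis using that by (simp add: me_def)
  qed
  interpret matrix_representation smul A d me
  proof unfold_locales
    show "1 \<in> A" using MA M(3) by blast
    show "y + z \<in> A" if "y \<in> A" "z \<in> A" for y z using that unfolding A_def by (rule span_add)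
    show "smul c y \<in> A" if "y \<in> A" for c y using that unfolding A_def by (rule span_scale)
    show "y * z \<in> A" if "y \<in> A" "z \<in> A" for y z using that by (rule A_mult)
  next
    fix y z i j assume "y \<in> A" "z \<in> A"
    then show "me (y + z) i j = me y i j + me z i j"
      using representation_add[OF B(2)] bsA by (simp add: me_def distrib_left AB)
  next
    fix y c i j assume "y \<in> A"
    then show "me (smul c y) i j = c * me y i j"
      using representation_scale[OF B(2)] bsA by (simp add: me_def mult_smul AB)
  next
    fix i j assume ij: "i < d" "j < d"
    then show "me 1 i j = (if i = j then 1 else 0)"
      using representation_basis[OF B(2) bsB[OF ij(1)]] nth_eq_iff_index_eq[OF bs(2), of i j]
      by (auto simp: me_def d_def)
  next
    fix y z i l assume yz: "y \<in> A" "z \<in> A" and il: "i < d" "l < d"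
    have "bs ! i * (y * z) = (\<Sum>j<d. smul (me y i j) (bs ! j * z))"
      unfolding mult.assoc[symmetric] expand[OF il(1) yz(1)] sum_distrib_right
      using A_lin[OF yz(2)] by (simp add: smul_mult)
    then have "me (y * z) i l = representation B (\<Sum>j<d. smul (me y i j) (bs ! j * z)) (bs ! l)"
      using il by (simp add: me_def)
    also have "\<dots> = (\<Sum>j<d. me y i j * me z j l)"
      using bsA[OF _ yz(2)] B(2)
      by (subst representation_sum)
        (auto simp: AB span_scale representation_scale me_def[of z] intro!: sum.cong)
    finally show "me (y * z) i l = (\<Sum>j<d. me y i j * me z j l)" .
  next
    fix y assume y: "y \<in> A" and 0: "\<And>i j. i < d \<Longrightarrow> j < d \<Longrightarrow> me y i j = 0"
    have B0: "b * y = 0" if "b \<in> B" for b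
    proof -
      have "b \<in> set bs" using that bs(1) by simp
      then obtain i where "i < d" "b = bs ! i" using in_set_conv_nth[of b bs] d_def by auto
      then show ?thesis using expand[of i y] y 0 by simp
    qed
    have "1 \<in> span B" using M(3) MA AB by blast
    then have "1 * y = 0"
      by (induction rule: span_induct_alt) (auto simp: distrib_right smul_mult[OF A_lin[OF y]] B0)
    then show "y = 0" by simp
  qed
  show ?thesis by (rule span_unipotent_nilpotent[OF M(1,2) MA M(3) unip a])
qed

text \<open>Used when \<open>(a - 1) ^ k = 0\<close>: then \<open>a ^ k\<close> is a combination of
  lower powers, so a power of a word reduces to shorter words.\<close>

lemma power_diff_one_expand: "(a - 1) ^ k - a ^ k \<in> span ((\<lambda>i. a ^ i) ` {..<k})"
proof (induction k)
  case (Suc k)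
  let ?r = "(a - 1) ^ k - a ^ k"
  have "?r \<in> span ((\<lambda>i. a ^ i) ` {..<Suc k})"
    by (rule subsetD[OF span_mono[OF image_mono] Suc]) auto
  moreover have "a * ?r \<in> span ((\<lambda>i. a ^ i) ` {..<Suc k})"
    by (rule span_mult_left[OF Suc]) (auto simp flip: power_Suc intro!: span_base)
  moreover have "a ^ k \<in> span ((\<lambda>i. a ^ i) ` {..<Suc k})" by (intro span_base) auto
  moreover have "(a - 1) ^ Suc k - a ^ Suc k = a * ?r - ?r - a ^ k" by (simp add: algebra_simps)
  ultimately show ?case by (simp only: span_diff)
qed simp

lemma unipotent_words_nilpotent:
  assumes I: "finite I" and lin: "\<And>i. i \<in> I \<Longrightarrow> lin (x i)"
    and unip: "\<And>w. w \<in> lists I \<Longrightarrow> \<exists>k. (ev x w - 1) ^ k = 0"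
    and id: "multilinear_identity n q A" and A: "span (ev x ` lists I) \<subseteq> A"
  shows "\<exists>L. \<forall>w\<in>lists I. L \<le> length w \<longrightarrow> ev (\<lambda>i. x i - 1) w = 0"
proof -
  define M where "M = ev x ` lists I"
  have evM: "ev x w \<in> M" if "w \<in> lists I" for w using that by (auto simp: M_def)
  have M_lin: "lin a" if "a \<in> M" for a using that lin by (auto simp: M_def intro!: lin_ev)
  have M_1: "1 \<in> M" using evM[of "[]"] by simp
  have M_mult: "a * b \<in> M" if ab: "a \<in> M" "b \<in> M" for a b
  proof -
    obtain v w where "v \<in> lists I" "w \<in> lists I" "a = ev x v" "b = ev x w" using ab by (auto simp: M_def)
    then show ?thesis using evM[of "v @ w"] by simp
  qed
  let ?R = "lenlex less_than"
  have "finite {w \<in> lists I. \<not> reducible ?R I x w}"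
  proof (rule finite_irreducible[OF admissible_lenlex _ I id])
    fix u assume u: "u \<in> lists I" "u \<noteq> []"
    obtain k where k: "(ev x u - 1) ^ k = 0" using unip u(1) by blast
    have "ev x u ^ k \<in> span ((\<lambda>i. ev x u ^ i) ` {..<k})"
      using span_neg[OF power_diff_one_expand[of "ev x u" k]] k by simp
    moreover have "(\<lambda>i. ev x u ^ i) ` {..<k} \<subseteq> ev x ` {v \<in> lists I. (v, concat (replicate k u)) \<in> ?R}"
    proof safe
      fix i assume "i < k"
      then have "(concat (replicate i u), concat (replicate k u)) \<in> ?R"
        using u(2) by (simp add: lenlex_conv length_concat sum_list_replicate)
      moreover have "concat (replicate i u) \<in> lists I" using u(1) by auto
      ultimately show "ev x u ^ i \<in> ev x ` {v \<in> lists I. (v, concat (replicate k u)) \<in> ?R}"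
        using ev_concat_replicate[of x i u, symmetric] by blast
    qed
    ultimately show "\<exists>k. reducible ?R I x (concat (replicate k u))"
      unfolding reducible_def using ev_concat_replicate[of x k u] subsetD[OF span_mono]
      by (intro exI[of _ k]) simp
  next
    show "ev x w \<in> A" if "w \<in> lists I" for w
      by (rule subsetD[OF A span_base]) (use that in auto)
  qed (rule lin)
  then have fin: "finite (ev x ` {w \<in> lists I. \<not> reducible ?R I x w})" by (rule finite_imageI)
  have gen: "M \<subseteq> span (ev x ` {w \<in> lists I. \<not> reducible ?R I x w})"
  proof
    fix a assume "a \<in> M"
    then obtain w where w: "w \<in> lists I" "a = ev x w" by (auto simp: M_def)
    show "a \<in> span (ev x ` {w \<in> lists I. \<not> reducible ?R I x w})"
      unfolding w(2)
      by (rule subsetD[OF span_mono in_span_irreducible[OF admissible_lenlex w(1)]]) auto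
  qed
  \<comment> \<open>The augmentation ideal: nil by the matrix argument, and closed under products,
    so it contains every nonempty word in the \<open>x i - 1\<close>.\<close>
  define \<Omega> where "\<Omega> = span ((\<lambda>h. h - 1) ` M)"
  have nil: "\<exists>k. a ^ k = 0" if "a \<in> \<Omega>" for a
    using finite_dim_unipotent_nilpotent[OF M_mult M_lin M_1 _ fin gen] unip that
    unfolding \<Omega>_def M_def by blast
  have \<Omega>_A: "\<Omega> \<subseteq> span M"
    unfolding \<Omega>_def using M_1 by (intro span_minimal) (auto intro: span_diff span_base)
  let ?y = "\<lambda>i. x i - 1"
  have y\<Omega>: "?y i \<in> \<Omega>" if "i \<in> I" for i
    using evM[of "[i]"] that unfolding \<Omega>_def by (auto intro!: span_base)
  have \<Omega>_mult: "a * b \<in> \<Omega>" if "a \<in> \<Omega>" "b \<in> \<Omega>" for a b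
    unfolding \<Omega>_def
  proof (rule span_mult[OF that[unfolded \<Omega>_def]])
    fix g h assume "g \<in> (\<lambda>h. h - 1) ` M" "h \<in> (\<lambda>h. h - 1) ` M"
    then obtain g' h' where gh: "g' \<in> M" "h' \<in> M" "g = g' - 1" "h = h' - 1" by blast
    have eq: "g * h = (g' * h' - 1) - (g' - 1) - (h' - 1)" unfolding gh(3,4) by (simp add: algebra_simps)
    have base: "a - 1 \<in> span ((\<lambda>h. h - 1) ` M)" if "a \<in> M" for a
      using that by (intro span_base imageI)
    show "g * h \<in> span ((\<lambda>h. h - 1) ` M)"
      unfolding eq by (rule span_diff[OF span_diff[OF base base] base]) (use gh M_mult in auto)
  next
    fix b assume "b \<in> (\<lambda>h. h - 1) ` M"
    then show "lin b" using lin_diff[OF M_lin lin_1] by blast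
  qed
  have ev_y: "ev ?y w \<in> \<Omega>" if "w \<in> lists I" "w \<noteq> []" for w
    using that
  proof (induction w)
    case (Cons i w)
    then show ?case using y\<Omega>[of i] \<Omega>_mult[of "?y i" "ev ?y w"] by (cases "w = []") simp_all
  qed simp
  let ?R = "lex less_than"
  have "finite {w \<in> lists I. \<not> reducible ?R I ?y w}"
  proof (rule finite_irreducible[OF admissible_lex _ I id])
    fix w assume "w \<in> lists I"
    then have "ev ?y w \<in> span M"
      using ev_y \<Omega>_A M_1 by (cases "w = []") (auto intro: span_base)
    then show "ev ?y w \<in> A" using A by (auto simp: M_def)
  next
    fix u assume u: "u \<in> lists I" "u \<noteq> []"
    then obtain k where "ev ?y u ^ k = 0" using nil ev_y by blast
    then show "\<exists>k. reducible ?R I ?y (concat (replicate k u))"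
      unfolding reducible_def using ev_concat_replicate[of ?y k u]
      by (intro exI[of _ k]) (simp add: span_zero)
  qed (intro lin_diff lin lin_1)
  then have "finite (length ` {w \<in> lists I. \<not> reducible ?R I ?y w})" by (rule finite_imageI)
  then obtain L where "\<forall>l\<in>length ` {w \<in> lists I. \<not> reducible ?R I ?y w}. l \<le> L"
    unfolding finite_nat_set_iff_bounded_le by (rule exE)
  then have L: "length w \<le> L" if "w \<in> lists I" "\<not> reducible ?R I ?y w" for w
    using that by simp
  have "ev ?y w = 0" if w: "w \<in> lists I" "Suc L \<le> length w" for w
  proof -
    \<comment> \<open>Words below \<open>w\<close> are as long as \<open>w\<close>, hence reducible,
      so the set of irreducible words whose span contains \<open>ev ?y w\<close> is empty.\<close>
    have len: "length v = length w" if "(v, w) \<in> ?R\<^sup>*" for v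
      using that
    proof (induction rule: converse_rtrancl_induct)
      case (step u v)
      then show ?case using lex_length_eq[OF step(1)] by simp
    qed simp
    have "reducible ?R I ?y v" if v: "v \<in> lists I" "(v, w) \<in> ?R\<^sup>*" for v
      using L[OF v(1)] len[OF v(2)] w(2) by linarith
    then have empty: "{v \<in> lists I. \<not> reducible ?R I ?y v \<and> (v, w) \<in> ?R\<^sup>*} = {}"
      by blast
    show ?thesis using in_span_irreducible[OF admissible_lex w(1), of ?y] unfolding empty by simp
  qed
  then show ?thesis by blast
qed

text \<open>The identity \<open>g h - 1 = (g - 1) (h - 1) + (g - 1) + (h - 1)\<close> passes from
  generators to all words: a product of \<open>L\<close> factors \<open>h - 1\<close> is a
  combination of words of length at least \<open>L\<close> in the \<open>x i - 1\<close>.\<close>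

theorem unipotent_monoid_nilpotent:
  assumes I: "finite I" and lin: "\<And>i. i \<in> I \<Longrightarrow> lin (x i)"
    and unip: "\<And>w. w \<in> lists I \<Longrightarrow> \<exists>k. (ev x w - 1) ^ k = 0"
    and id: "multilinear_identity n q A" and A: "span (ev x ` lists I) \<subseteq> A"
  shows "\<exists>L. \<forall>hs. set hs \<subseteq> ev x ` lists I \<and> length hs = L \<longrightarrow> prod_list (map (\<lambda>h. h - 1) hs) = 0"
proof -
  let ?y = "\<lambda>i. x i - 1"
  have "\<exists>L. \<forall>w\<in>lists I. L \<le> length w \<longrightarrow> ev ?y w = 0"
    by (rule unipotent_words_nilpotent[of I x n q A]) (fact assms)+
  then obtain L where L: "\<And>w. w \<in> lists I \<Longrightarrow> L \<le> length w \<Longrightarrow> ev ?y w = 0"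
    by blast
  define J where "J k = span (ev ?y ` {w \<in> lists I. k \<le> length w})" for k
  have J_mult: "a * b \<in> J (k + l)" if ab: "a \<in> J k" "b \<in> J l" for a b k l
    unfolding J_def
  proof (rule span_mult[OF ab[unfolded J_def]])
    fix a b assume "a \<in> ev ?y ` {w \<in> lists I. k \<le> length w}" "b \<in> ev ?y ` {w \<in> lists I. l \<le> length w}"
    then obtain v w where "v \<in> lists I" "w \<in> lists I" "k \<le> length v" "l \<le> length w" "a = ev ?y v" "b = ev ?y w"
      by blast
    then show "a * b \<in> span (ev ?y ` {w \<in> lists I. k + l \<le> length w})"
      by (intro span_base image_eqI[of _ _ "v @ w"]) auto
  next
    fix b assume "b \<in> ev ?y ` {w \<in> lists I. l \<le> length w}"
    then obtain w where "w \<in> lists I" "b = ev ?y w" by blast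
    then show "lin b" using lin_ev[of w ?y] lin_diff[OF lin lin_1] by auto
  qed
  have J_add: "a + b \<in> J k" if "a \<in> J k" "b \<in> J k" for a b k
    using that unfolding J_def by (rule span_add)
  have J_mono: "J l \<subseteq> J k" if "k \<le> l" for k l
    unfolding J_def using that by (intro span_mono image_mono) auto
  have J_1: "ev x w - 1 \<in> J 1" if "w \<in> lists I" for w
    using that
  proof (induction w)
    case Nil
    show ?case by (simp add: J_def span_zero)
  next
    case (Cons i w)
    have "?y i = ev ?y [i]" by simp
    then have yi: "?y i \<in> J 1"
      unfolding J_def using Cons.hyps by (intro span_base image_eqI[of _ _ "[i]"]) auto
    have "ev x (i # w) - 1 = ?y i * (ev x w - 1) + ?y i + (ev x w - 1)" by (simp add: algebra_simps)
    moreover have "?y i * (ev x w - 1) \<in> J 1"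
      using J_mult[OF yi Cons.IH] J_mono[of 1 "1 + 1"] by auto
    ultimately show ?case using yi Cons.IH J_add by (metis (no_types))
  qed
  have "prod_list (map (\<lambda>h. h - 1) hs) \<in> J (length hs)" if "set hs \<subseteq> ev x ` lists I" for hs
    using that
  proof (induction hs)
    case Nil
    show ?case unfolding J_def by (auto intro!: span_base image_eqI[of _ _ "[]"])
  next
    case (Cons h hs)
    then show ?case using J_mult[of "h - 1" 1] J_1 by auto
  qed
  moreover have "J L \<subseteq> {0}"
    unfolding J_def using L by (intro span_minimal) auto
  ultimately have "prod_list (map (\<lambda>h. h - 1) hs) = 0" if "set hs \<subseteq> ev x ` lists I" "length hs = L" for hs
    using that by blast
  then show ?thesis by blast
qed

end

section \<open>Multilinear identities and products of unipotent elements\<close>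

lemma prod_list_zero: "0 \<in> set xs \<Longrightarrow> prod_list xs = (0::'a::{ring,monoid_mult})"
  by (induction xs) auto

text \<open>Expanding the product means choosing, for each position of \<open>v\<close>, an index
  \<open>j\<close> with \<open>w ! j\<close> equal to the letter there; \<open>u\<close> is the list
  of choices.\<close>

lemma prod_list_sum_expand:
  fixes y :: "nat \<Rightarrow> 'a::{ring,monoid_mult}"
  shows "prod_list (map (\<lambda>i. \<Sum>j | j < n \<and> w ! j = i. y j) v) =
    (\<Sum>u | u \<in> lists {..<n} \<and> map ((!) w) u = v. prod_list (map y u))"
proof (induction v)
  case Nil
  have "{u. u \<in> lists {..<n} \<and> map ((!) w) u = []} = {[]}" by auto
  then show ?case by simp
next
  case (Cons i v)
  let ?J = "{j. j < n \<and> w ! j = i}" and ?U = "{u. u \<in> lists {..<n} \<and> map ((!) w) u = v}"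
  have bij: "bij_betw (\<lambda>(j, u). j # u) (?J \<times> ?U) {u. u \<in> lists {..<n} \<and> map ((!) w) u = i # v}"
    by (rule bij_betwI[where g = "\<lambda>u. (hd u, tl u)"]) auto
  have "prod_list (map (\<lambda>i. \<Sum>j | j < n \<and> w ! j = i. y j) (i # v)) =
      (\<Sum>j\<in>?J. y j) * (\<Sum>u\<in>?U. prod_list (map y u))"
    using Cons by simp
  also have "\<dots> = (\<Sum>(j, u)\<in>?J \<times> ?U. prod_list (map y (j # u)))"
    by (simp add: sum_product sum.cartesian_product)
  also have "\<dots> = (\<Sum>u | u \<in> lists {..<n} \<and> map ((!) w) u = i # v. prod_list (map y u))"
    using sum.reindex_bij_betw[OF bij, of "\<lambda>u. prod_list (map y u)"] by (simp add: case_prod_beta)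
  finally show ?case .
qed

context right_algebra
begin

text \<open>Linearization in one step: for a monomial \<open>w\<close> of maximal length \<open>n\<close>, substitute
  \<open>\<Sum>\<^bsub>w ! j = i\<^esub> y\<^sub>j\<close> for the \<open>i\<close>-th variable and keep the part involving all of
  \<open>y\<^sub>0, \<dots>, y\<^sub>n\<^sub>-\<^sub>1\<close>, which is multilinear for degree reasons.\<close>

theorem multilinear_identity_of_identity:
  fixes p :: "'k nc_poly"
  assumes p: "p \<noteq> 0" and A: "0 \<in> A" "\<And>a b. a \<in> A \<Longrightarrow> b \<in> A \<Longrightarrow> a + b \<in> A"
    and id: "\<And>a. (\<And>i. a i \<in> A) \<Longrightarrow> nc_eval smul (*) 1 a p = 0"
  shows "\<exists>n q. multilinear_identity n q A"
proof -
  let ?K = "Poly_Mapping.keys p"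
  have "?K \<noteq> {}" using p by simp
  then have "Max (length ` ?K) \<in> length ` ?K" by (intro Max_in) auto
  then obtain w where w: "w \<in> ?K" "length w = Max (length ` ?K)" by auto
  define n where "n = length w"
  have len: "length v \<le> n" if "v \<in> ?K" for v
    using that w(2) by (auto simp: n_def intro!: Max_ge)
  define g where "g = map ((!) w)"
  define q where "q u = Poly_Mapping.lookup p (g u)" for u
  define W where "W = {u \<in> lists {..<n}. g u \<in> ?K}"
  have W_len: "length u \<le> n" if "u \<in> W" for u
    using that len[of "g u"] by (simp add: W_def g_def)
  have finW: "finite W"
    by (rule finite_bounded_words[of _ "{..<n}" n]) (use W_len in \<open>auto simp: W_def\<close>)
  define \<phi> where "\<phi> y u = smul (q u) (prod_list (map y u))" for y :: "nat \<Rightarrow> 'a" and u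
  have W0: "(\<Sum>u\<in>W. \<phi> y u) = 0" if y: "\<And>i. y i \<in> A" for y
  proof -
    let ?a = "\<lambda>i. \<Sum>j | j < n \<and> w ! j = i. y j"
    have "sum y J \<in> A" for J
      by (induction J rule: infinite_finite_induct) (auto intro: A y)
    then have "?a i \<in> A" for i .
    then have "0 = nc_eval smul (*) 1 ?a p" using id by simp
    also have "\<dots> = (\<Sum>v\<in>?K. smul (Poly_Mapping.lookup p v) (\<Sum>u | u \<in> lists {..<n} \<and> g u = v. prod_list (map y u)))"
      unfolding nc_eval_def g_def
      by (simp only: prod_list_sum_expand[symmetric] prod_list.eq_foldr[symmetric])
    also have "\<dots> = (\<Sum>v\<in>?K. \<Sum>u | u \<in> W \<and> g u = v. \<phi> y u)"
      by (intro sum.cong refl) (auto simp: scale_sum_right \<phi>_def q_def W_def intro!: sum.cong)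
    also have "\<dots> = (\<Sum>u\<in>W. \<phi> y u)"
      by (rule sum.group[OF finW]) (auto simp: W_def)
    finally show ?thesis by simp
  qed
  \<comment> \<open>Setting \<open>y x = 0\<close> kills the terms containing \<open>x\<close>;
    comparison with the unchanged identity shows that these terms sum to zero on their own.\<close>
  have cover: "(\<Sum>u | u \<in> W \<and> D \<subseteq> set u. \<phi> y u) = 0" if "finite D" "\<And>i. y i \<in> A" for D y
    using that
  proof (induction D arbitrary: y rule: finite_induct)
    case empty
    then show ?case using W0 by simp
  next
    case (insert x D)
    let ?y = "y(x := 0)"
    have split: "(\<Sum>u | u \<in> W \<and> D \<subseteq> set u. f u) =
        (\<Sum>u | u \<in> W \<and> insert x D \<subseteq> set u. f u) + (\<Sum>u | u \<in> W \<and> D \<subseteq> set u \<and> x \<notin> set u. f u)"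
      for f :: "nat list \<Rightarrow> 'a"
      by (subst sum.union_disjoint[symmetric]) (use finW in \<open>auto intro!: sum.cong\<close>)
    have "(\<Sum>u | u \<in> W \<and> insert x D \<subseteq> set u. \<phi> ?y u) = 0"
      by (rule sum.neutral) (auto simp: \<phi>_def intro!: prod_list_zero)
    moreover have "(\<Sum>u | u \<in> W \<and> D \<subseteq> set u \<and> x \<notin> set u. \<phi> ?y u) =
        (\<Sum>u | u \<in> W \<and> D \<subseteq> set u \<and> x \<notin> set u. \<phi> y u)"
      by (intro sum.cong) (auto simp: \<phi>_def intro!: arg_cong[of _ _ prod_list] arg_cong2[of _ _ _ _ smul])
    moreover have "(\<Sum>u | u \<in> W \<and> D \<subseteq> set u. \<phi> ?y u) = 0" "(\<Sum>u | u \<in> W \<and> D \<subseteq> set u. \<phi> y u) = 0"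
      by (rule insert.IH, use insert.prems A(1) in simp)+
    ultimately show ?case using split[of "\<phi> ?y"] split[of "\<phi> y"] by simp
  qed
  have "(\<Sum>u\<in>permutations_of_set {..<n}. \<phi> y u) = 0" if y: "\<And>i. y i \<in> A" for y
  proof -
    have "{u. u \<in> W \<and> {..<n} \<subseteq> set u} \<subseteq> permutations_of_set {..<n}"
    proof
      fix u assume "u \<in> {u. u \<in> W \<and> {..<n} \<subseteq> set u}"
      then have u: "set u = {..<n}" "length u \<le> n" using W_len by (auto simp: W_def)
      then have "card (set u) = length u" using card_length[of u] by simp
      then have "distinct u" by (rule card_distinct)
      with u(1) show "u \<in> permutations_of_set {..<n}" by (rule permutations_of_setI)
    qed
    moreover have "\<phi> y u = 0" if "u \<in> permutations_of_set {..<n} - {u. u \<in> W \<and> {..<n} \<subseteq> set u}" for u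
    proof -
      have "g u \<notin> ?K" using that by (auto simp: W_def permutations_of_set_def)
      then show ?thesis by (simp add: \<phi>_def q_def in_keys_iff)
    qed
    ultimately have "(\<Sum>u\<in>permutations_of_set {..<n}. \<phi> y u) = (\<Sum>u | u \<in> W \<and> {..<n} \<subseteq> set u. \<phi> y u)"
      by (intro sum.mono_neutral_right) auto
    then show ?thesis using cover[of "{..<n}" y] y by simp
  qed
  \<comment> \<open>\<open>g [0..<n]\<close> is the chosen monomial \<open>w\<close>, which occurs
    in \<open>p\<close>.\<close>
  moreover have "q [0..<n] \<noteq> 0"
    using w(1) by (simp add: q_def g_def n_def map_nth in_keys_iff)
  ultimately have "multilinear_identity n q A"
    unfolding multilinear_identity_def \<phi>_def by blast
  then show ?thesis by blast
qed

section \<open>Products of two unipotent elements\<close>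

lemma power_in_span:
  assumes "(a - 1) ^ m = 0"
  shows "a ^ i \<in> span ((\<lambda>j. a ^ j) ` {..<m})"
proof (induction i)
  case 0
  show ?case
  proof (cases m)
    case 0
    then have "a ^ 0 = 0" using assms by simp
    then show ?thesis using span_zero by metis
  qed (auto intro!: span_base image_eqI[of _ _ 0])
next
  case (Suc i)
  have am: "a ^ m \<in> span ((\<lambda>j. a ^ j) ` {..<m})"
    using span_neg[OF power_diff_one_expand[of a m]] assms by simp
  have "a * a ^ j \<in> span ((\<lambda>j. a ^ j) ` {..<m})" if "j < m" for j
  proof (cases "Suc j = m")
    case True
    then show ?thesis using am by (metis power_Suc)
  next
    case False
    with that show ?thesis by (intro span_base image_eqI[of _ _ "Suc j"]) auto
  qed
  then have "a * a ^ i \<in> span ((\<lambda>j. a ^ j) ` {..<m})"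
    by (intro span_mult_left[OF Suc]) auto
  then show ?case by simp
qed

lemma prod_list_in_span:
  assumes "set es \<subseteq> span B" "\<And>b. b \<in> B \<Longrightarrow> lin b"
  shows "prod_list es \<in> span {prod_list bs |bs. set bs \<subseteq> B \<and> length bs = length es}"
  using assms(1)
proof (induction es)
  case Nil
  show ?case by (auto intro!: span_base)
next
  case (Cons e es)
  have "e * prod_list es \<in> span {prod_list bs |bs. set bs \<subseteq> B \<and> length bs = Suc (length es)}"
  proof (rule span_mult[of _ B])
    show "e \<in> span B" "prod_list es \<in> span {prod_list bs |bs. set bs \<subseteq> B \<and> length bs = length es}"
      using Cons by auto
    fix c assume "c \<in> {prod_list bs |bs. set bs \<subseteq> B \<and> length bs = length es}"
    then obtain bs where bs: "set bs \<subseteq> B" "length bs = length es" "c = prod_list bs" by blast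
    show "lin c" unfolding bs(3) by (rule lin_prod_list) (use bs(1) assms(2) in blast)
    fix b assume "b \<in> B"
    with bs show "b * c \<in> span {prod_list bs |bs. set bs \<subseteq> B \<and> length bs = Suc (length es)}"
      by (intro span_base CollectI exI[of _ "b # bs"]) auto
  qed
  then show ?case by simp
qed

text \<open>The conjugates \<open>b\<^sup>i (a - 1) b\<^sup>-\<^sup>i\<close> span a finite-dimensional space \<open>E\<close>, so all long products from
  \<open>E\<close> vanish. On the successive quotients of the filtration of the algebra by the annihilators
  \<open>I j = {x. x E\<^sup>j = 0}\<close>, multiplication by \<open>a b - 1\<close> agrees with multiplication by \<open>b - 1\<close>.\<close>

lemma unipotent_mult:
  assumes bb': "b * b' = 1" "b' * b = 1" and lin: "lin a" "lin b" "lin b'"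
    and m: "(b - 1) ^ m = 0" "(b' - 1) ^ m' = 0"
    and fin: "\<And>F :: nat set. finite F \<Longrightarrow> \<exists>k. \<forall>es. set es \<subseteq> (\<lambda>i. b ^ i * (a - 1) * b' ^ i) ` F \<and> length es = k
                 \<longrightarrow> prod_list es = 0"
  shows "\<exists>r. (a * b - 1) ^ r = 0"
proof -
  define e where "e i = b ^ i * (a - 1) * b' ^ i" for i :: nat
  let ?W = "(\<lambda>(i, j). b ^ i * (a - 1) * b' ^ j) ` ({..<m} \<times> {..<m'})"
  have eW: "e i \<in> span ?W" for i
    unfolding e_def
  proof (rule span_mult[of _ "(\<lambda>i. b ^ i * (a - 1)) ` {..<m}" _ "(\<lambda>j. b' ^ j) ` {..<m'}"])
    show "b ^ i * (a - 1) \<in> span ((\<lambda>i. b ^ i * (a - 1)) ` {..<m})"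
      by (rule span_mult_right[OF power_in_span[OF m(1)] lin_diff[OF lin(1) lin_1]]) (auto intro: span_base)
    show "b' ^ i \<in> span ((\<lambda>j. b' ^ j) ` {..<m'})" by (rule power_in_span[OF m(2)])
  qed (auto intro!: lin_power lin(3) span_base)
  obtain B where B: "B \<subseteq> range e" "independent B" "range e \<subseteq> span B"
    by (rule maximal_independent_subset)
  have "finite B" using independent_span_bound[OF _ B(2), of ?W] B(1) eW by auto
  then obtain F where F: "finite F" "B = e ` F" using finite_subset_image[OF _ B(1)] by blast
  obtain k where k: "\<And>es. set es \<subseteq> B \<Longrightarrow> length es = k \<Longrightarrow> prod_list es = 0"
    using fin[OF F(1)] unfolding F(2) e_def by blast
  have e_lin: "lin (e i)" for i
    unfolding e_def by (intro lin_mult lin_power lin lin_diff lin_1)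
  have ek: "prod_list es = 0" if "set es \<subseteq> range e" "length es = k" for es
  proof -
    have "prod_list es \<in> span {prod_list bs |bs. set bs \<subseteq> B \<and> length bs = length es}"
      by (rule prod_list_in_span) (use that B e_lin in auto)
    also have "\<dots> \<subseteq> span {0}" using k that(2) by (intro span_mono) auto
    finally show ?thesis by simp
  qed
  define I where "I j = {x. \<forall>es. set es \<subseteq> range e \<and> j \<le> length es \<longrightarrow> x * prod_list es = 0}" for j
  have I_add: "x + y \<in> I j" if "x \<in> I j" "y \<in> I j" for x y j
    using that by (simp add: I_def distrib_right)
  have I_mono: "x \<in> I (Suc j)" if "x \<in> I j" for x j
    using that by (simp add: I_def)
  have I_e: "x * e 0 \<in> I j" if "x \<in> I (Suc j)" for x j
    unfolding I_def
  proof safe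
    fix es assume es: "set es \<subseteq> range e" "j \<le> length es"
    have "x * prod_list (e 0 # es) = 0" using that es unfolding I_def
      by (auto simp del: prod_list.Cons)
    then show "x * e 0 * prod_list es = 0" by (simp add: mult.assoc)
  qed
  have I_b: "x * b \<in> I j" if x: "x \<in> I j" for x j
    unfolding I_def
  proof safe
    fix es assume es: "set es \<subseteq> range e" "j \<le> length es"
    \<comment> \<open>Moving \<open>b\<close> across a product conjugates each factor, and
      conjugation sends \<open>e i\<close> to \<open>e (Suc i)\<close>; this is why \<open>E\<close>
      contains all these conjugates.\<close>
    have conj: "b * prod_list es = prod_list (map (\<lambda>y. b * y * b') es) * b"
    proof (induction es)
      case (Cons y es)
      have "b * prod_list (y # es) = b * y * b' * (b * prod_list es)"
        using bb'(2) by (simp add: mult.assoc) (metis mult.assoc mult_1_left)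
      then show ?case using Cons by (simp add: mult.assoc)
    qed simp
    have "b * e i * b' = e (Suc i)" for i
      unfolding e_def power_Suc[of b] power_Suc2[of b'] by (simp add: mult.assoc)
    then have "set (map (\<lambda>y. b * y * b') es) \<subseteq> range e" using es(1) by auto
    then have "x * prod_list (map (\<lambda>y. b * y * b') es) = 0"
      using x es(2) unfolding I_def by simp
    then show "x * b * prod_list es = 0"
      unfolding mult.assoc conj by (simp add: mult.assoc[symmetric])
  qed
  have I_b1: "x * (b - 1) \<in> I j" if "x \<in> I j" for x j
    using that I_b[OF that] by (simp add: I_def right_diff_distrib left_diff_distrib)
  have I_b1r: "x * (b - 1) ^ r \<in> I j" if "x \<in> I j" for x j r
    using that
  proof (induction r)
    case (Suc r)
    then show ?case using I_b1[of "x * (b - 1) ^ r" j] by (simp only: power_Suc2 mult.assoc)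
  qed simp
  let ?c = "a * b - 1"
  \<comment> \<open>Since \<open>e 0 = a - 1\<close>, the first summand drops one level of the
    filtration and only \<open>b - 1\<close> acts on the quotient.\<close>
  have c: "x * ?c = x * e 0 * b + x * (b - 1)" for x
    by (simp add: e_def algebra_simps)
  have I_c: "x * ?c \<in> I j" if "x \<in> I j" for x j
    unfolding c using that I_mono I_e I_b I_b1 I_add by meson
  have approx: "\<exists>z\<in>I j. x * ?c ^ r = x * (b - 1) ^ r + z" if x: "x \<in> I (Suc j)" for x j r
  proof (induction r)
    case 0
    show ?case by (intro bexI[of _ 0]) (auto simp: I_def)
  next
    case (Suc r)
    then obtain z where z: "z \<in> I j" "x * ?c ^ r = x * (b - 1) ^ r + z" by blast
    let ?y = "x * (b - 1) ^ r"
    have "x * ?c ^ Suc r = (?y + z) * ?c" unfolding power_Suc2 mult.assoc[symmetric] z(2) ..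
    also have "\<dots> = x * (b - 1) ^ Suc r + (?y * e 0 * b + z * ?c)"
      unfolding distrib_right c[of ?y] power_Suc2 by (simp add: mult.assoc add.assoc)
    finally show ?case using I_add[OF I_b[OF I_e[OF I_b1r[OF x]]] I_c[OF z(1)]] by blast
  qed
  \<comment> \<open>Every \<open>m\<close> factors lower the level by one, starting from
    \<open>1 \<in> I k\<close>; at level 0 the empty product shows that the element is zero.\<close>
  have "?c ^ (m * i) \<in> I (k - i)" if "i \<le> k" for i
    using that
  proof (induction i)
    case 0
    have "prod_list es = 0" if "set es \<subseteq> range e" "k \<le> length es" for es
    proof -
      have "prod_list es = prod_list (take k es) * prod_list (drop k es)"
        by (metis append_take_drop_id prod_list.append)
      moreover have "prod_list (take k es) = 0"
        using that by (intro ek) (auto dest: in_set_takeD)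
      ultimately show ?thesis by simp
    qed
    then show ?case by (simp add: I_def)
  next
    case (Suc i)
    then have "?c ^ (m * i) \<in> I (Suc (k - Suc i))" by (simp add: Suc_diff_Suc)
    from approx[OF this, of m] have "?c ^ (m * i) * ?c ^ m \<in> I (k - Suc i)" using m(1) by auto
    then show ?case by (simp add: power_add[symmetric] add.commute)
  qed
  from this[of k] have "?c ^ (m * k) \<in> I 0" by simp
  then have "set [] \<subseteq> range e \<and> 0 \<le> length ([] :: 'a list) \<longrightarrow> ?c ^ (m * k) * prod_list [] = 0"
    unfolding I_def mem_Collect_eq by (rule spec)
  then show ?thesis by auto
qed

end

section \<open>The unipotent radical\<close>

typedef (overloaded) 'v endo = "{f :: 'v::ab_group_add \<Rightarrow> 'v. \<forall>x y. f (x + y) = f x + f y}"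
  morphisms app Endo
  by (rule exI[of _ "\<lambda>x. x"]) simp

setup_lifting type_definition_endo

text \<open>As in \<open>aut_group\<close>, the product of \<open>f\<close> and \<open>g\<close> is "first \<open>f\<close>, then \<open>g\<close>".\<close>

instantiation endo :: (ab_group_add) "{ring, monoid_mult}"
begin

lift_definition zero_endo :: "'a endo" is "\<lambda>_. 0" by simp
lift_definition one_endo :: "'a endo" is "\<lambda>x. x" by simp
lift_definition plus_endo :: "'a endo \<Rightarrow> 'a endo \<Rightarrow> 'a endo" is "\<lambda>f g x. f x + g x"
  by (simp add: ac_simps)
lift_definition minus_endo :: "'a endo \<Rightarrow> 'a endo \<Rightarrow> 'a endo" is "\<lambda>f g x. f x - g x"
  by (simp add: algebra_simps)
lift_definition uminus_endo :: "'a endo \<Rightarrow> 'a endo" is "\<lambda>f x. - f x"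
  by simp
lift_definition times_endo :: "'a endo \<Rightarrow> 'a endo \<Rightarrow> 'a endo" is "\<lambda>f g x. g (f x)"
  by simp

instance
  by standard (transfer; simp add: fun_eq_iff algebra_simps)+

end

lemma app_simps [simp]:
  "app 0 x = 0" "app 1 x = x" "app (f + g) x = app f x + app g x" "app (f - g) x = app f x - app g x"
  "app (f * g) x = app g (app f x)"
  by (transfer; simp)+

lemma app_add: "app f (x + y) = app f x + app f y"
  by transfer simp

lemma endo_eqI: "(\<And>x. app f x = app g x) \<Longrightarrow> f = g"
  by transfer auto

lemma app_sum: "app (sum f I) x = (\<Sum>i\<in>I. app (f i) x)"
  by (induction I rule: infinite_finite_induct) auto

lemma sum_fun_apply: "(\<Sum>i\<in>I. f i) x = (\<Sum>i\<in>I. f i x)"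
  by (induction I rule: infinite_finite_induct) auto

context group_rep
begin

definition endo_smul :: "'k \<Rightarrow> 'v endo \<Rightarrow> 'v endo" where
  "endo_smul c f = Endo (\<lambda>v. scale c (app f v))"

lemma app_endo_smul [simp]: "app (endo_smul c f) v = scale c (app f v)"
  unfolding endo_smul_def by (subst Endo_inverse) (auto simp: app_add scale_right_distrib)

sublocale E: right_algebra endo_smul
  by unfold_locales (auto intro!: endo_eqI simp: scale_right_distrib scale_left_distrib)

lemma rho_linear: "g \<in> carrier G \<Longrightarrow> Vector_Spaces.linear scale scale (\<rho> g)"
  using hom_rho by (auto simp: hom_def aut_group_def)

lemma rho_add: "g \<in> carrier G \<Longrightarrow> \<rho> g (x + y) = \<rho> g x + \<rho> g y"
  and rho_scale: "g \<in> carrier G \<Longrightarrow> \<rho> g (scale c x) = scale c (\<rho> g x)"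
proof -
  assume "g \<in> carrier G"
  then interpret f: Vector_Spaces.linear scale scale "\<rho> g" by (rule rho_linear)
  show "\<rho> g (x + y) = \<rho> g x + \<rho> g y" "\<rho> g (scale c x) = scale c (\<rho> g x)"
    by (rule f.add f.scale)+
qed

definition act :: "'g \<Rightarrow> 'v endo" where "act g = Endo (\<rho> g)"

lemma app_act [simp]: "g \<in> carrier G \<Longrightarrow> app (act g) v = \<rho> g v"
  unfolding act_def by (subst Endo_inverse) (auto simp: rho_add)

lemma act_lin: "g \<in> carrier G \<Longrightarrow> E.lin (act g)"
  unfolding E.lin_def by (auto intro!: endo_eqI simp: rho_scale)

lemma act_mult: "g \<in> carrier G \<Longrightarrow> h \<in> carrier G \<Longrightarrow> act (g \<otimes>\<^bsub>G\<^esub> h) = act g * act h"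
  using hom_rho by (auto intro!: endo_eqI simp: hom_def aut_group_def)

lemma act_one: "act \<one>\<^bsub>G\<^esub> = 1"
proof -
  interpret h: group_hom G "aut_group scale" \<rho>
    by (intro group_hom.intro group_hom_axioms.intro) (auto simp: hom_rho aut_group_is_group intro: is_group)
  show ?thesis using h.hom_one by (auto intro!: endo_eqI simp: aut_group_def)
qed

lemma act_inv: "g \<in> carrier G \<Longrightarrow> act g * act (inv\<^bsub>G\<^esub> g) = 1" "g \<in> carrier G \<Longrightarrow> act (inv\<^bsub>G\<^esub> g) * act g = 1"
  by (simp_all add: act_mult[symmetric] act_one)

lemma act_pow: "g \<in> carrier G \<Longrightarrow> act (g [^]\<^bsub>G\<^esub> (i::nat)) = act g ^ i"
  by (induction i) (simp_all add: act_mult act_one power_Suc2 del: power_Suc)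

lemma foldl_act:
  "set gs \<subseteq> carrier G \<Longrightarrow> foldl (\<lambda>x g. act_minus_one \<rho> g x) v gs = app (prod_list (map (\<lambda>g. act g - 1) gs)) v"
  by (induction gs arbitrary: v) (auto simp: act_minus_one_def)

lemma funpow_act: "g \<in> carrier G \<Longrightarrow> (act_minus_one \<rho> g ^^ n) v = app ((act g - 1) ^ n) v"
  by (induction n arbitrary: v) (auto simp: act_minus_one_def power_Suc2 simp del: power_Suc)

lemma unipotent_iff:
  assumes "N \<subseteq> carrier G"
  shows "unipotent_rep (G\<lparr>carrier := N\<rparr>) \<rho> \<longleftrightarrow> (\<forall>g\<in>N. \<exists>n. (act g - 1) ^ n = 0)"
proof -
  have "(\<forall>x. (act_minus_one \<rho> g ^^ n) x = 0) \<longleftrightarrow> (act g - 1) ^ n = 0" if "g \<in> N" for g n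
    using funpow_act[of g n] that assms by (auto intro!: endo_eqI)
  then show ?thesis by (simp add: unipotent_rep_def)
qed

lemma unitriangular_iff:
  assumes "N \<subseteq> carrier G"
  shows "unitriangular_rep (G\<lparr>carrier := N\<rparr>) \<rho> \<longleftrightarrow>
    (\<exists>n. \<forall>gs. set gs \<subseteq> N \<and> length gs = n \<longrightarrow> prod_list (map (\<lambda>g. act g - 1) gs) = 0)"
proof -
  have "(\<forall>v. foldl (\<lambda>x g. act_minus_one \<rho> g x) v gs = 0) \<longleftrightarrow> prod_list (map (\<lambda>g. act g - 1) gs) = 0"
    if "set gs \<subseteq> N" for gs
    using foldl_act[of gs] that assms by (auto intro!: endo_eqI)
  then have "(\<forall>v gs. length gs = n \<and> set gs \<subseteq> N \<longrightarrow> foldl (\<lambda>x g. act_minus_one \<rho> g x) v gs = 0) \<longleftrightarrow>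
      (\<forall>gs. set gs \<subseteq> N \<and> length gs = n \<longrightarrow> prod_list (map (\<lambda>g. act g - 1) gs) = 0)" for n
    by blast
  then show ?thesis by (simp add: unitriangular_rep_def)
qed

lemma locally_unitriangular_iff:
  assumes "subgroup N G"
  shows "locally_unitriangular_rep (G\<lparr>carrier := N\<rparr>) \<rho> \<longleftrightarrow>
    (\<forall>S. finite S \<and> S \<subseteq> N \<longrightarrow> unitriangular_rep (G\<lparr>carrier := generate G S\<rparr>) \<rho>)"
  using generate_consistent[OF _ assms] by (auto simp: locally_unitriangular_rep_def)

text \<open>\<open>app\<close> carries substitutions from the span in \<open>endo\<close> into the
  span of maps in the hypothesis and respects sums, scalars and the order of products; so the
  identity is pulled back and then linearized.\<close>

lemma PI_multilinear_identity:
  assumes "PI_rep scale G \<rho>"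
  shows "\<exists>n q. E.multilinear_identity n q (E.span (act ` carrier G))"
proof -
  interpret F: Modules.module "end_scale scale"
    by unfold_locales (auto simp: end_scale_def fun_eq_iff scale_right_distrib scale_left_distrib)
  obtain p :: "'k nc_poly" where p: "p \<noteq> 0"
    "\<And>a. (\<And>i. a i \<in> F.span (\<rho> ` carrier G)) \<Longrightarrow> nc_eval (end_scale scale) (\<lambda>f g. g \<circ> f) id a p = 0"
    using assms unfolding PI_rep_def PI_algebra_def faithful_image_eq by blast
  have app_span: "app f \<in> F.span (\<rho> ` carrier G)" if "f \<in> E.span (act ` carrier G)" for f
    using that
  proof (induction rule: E.span_induct_alt)
    case base
    have zero: "app (0 :: 'v endo) = 0" by (simp add: fun_eq_iff)
    show ?case unfolding zero by (rule F.span_zero)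
  next
    case (step c x y)
    then obtain g where g: "g \<in> carrier G" "x = act g" by blast
    then have eq: "app (endo_smul c x + y) = end_scale scale c (\<rho> g) + app y"
      by (simp add: fun_eq_iff end_scale_def)
    show ?case unfolding eq
      by (rule F.span_add[OF F.span_scale[OF F.span_base[OF imageI[OF g(1)]]] step(2)])
  qed
  have foldr_app: "foldr (\<lambda>f g. g \<circ> f) (map (\<lambda>i. app (a i)) w) id = app (prod_list (map a w))"
    for a :: "nat \<Rightarrow> 'v endo" and w
    by (induction w) (auto simp: fun_eq_iff)
  show ?thesis
  proof (rule E.multilinear_identity_of_identity[OF p(1)])
    fix a :: "nat \<Rightarrow> 'v endo" assume a: "\<And>i. a i \<in> E.span (act ` carrier G)"
    have "nc_eval (end_scale scale) (\<lambda>f g. g \<circ> f) id (\<lambda>i. app (a i)) p = 0"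
      by (rule p(2)) (rule app_span[OF a])
    then have "(\<Sum>w\<in>Poly_Mapping.keys p. end_scale scale (Poly_Mapping.lookup p w) (app (prod_list (map a w)))) = 0"
      unfolding nc_eval_def foldr_app .
    then have "(\<Sum>w\<in>Poly_Mapping.keys p. scale (Poly_Mapping.lookup p w) (app (prod_list (map a w)) v)) = 0" for v
      by (auto simp: fun_eq_iff sum_fun_apply end_scale_def dest!: fun_cong[of _ _ v])
    then show "nc_eval endo_smul (*) 1 a p = 0"
      unfolding nc_eval_def prod_list.eq_foldr[symmetric] by (intro endo_eqI) (simp add: app_sum)
  qed (auto intro: E.span_zero E.span_add)
qed

text \<open>Adding inverses to the finite generating set makes the subgroup a finitely generated
  monoid, all of whose words act unipotently as elements of \<open>N\<close>. Its span inherits the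
  identity of the whole group.\<close>

lemma unipotent_imp_locally_unitriangular:
  assumes PI: "PI_rep scale G \<rho>" and N: "subgroup N G"
    and unip: "unipotent_rep (G\<lparr>carrier := N\<rparr>) \<rho>"
  shows "locally_unitriangular_rep (G\<lparr>carrier := N\<rparr>) \<rho>"
  unfolding locally_unitriangular_iff[OF N]
proof (intro allI impI)
  fix S assume S: "finite S \<and> S \<subseteq> N"
  interpret N: subgroup N G by (fact N)
  obtain n q where id: "E.multilinear_identity n q (E.span (act ` carrier G))"
    using PI_multilinear_identity[OF PI] by blast
  have "finite (S \<union> m_inv G ` S)" using S by blast
  from finite_list[OF this] obtain gs where gs: "set gs = S \<union> m_inv G ` S" ..
  have gsN: "gs ! i \<in> N" if "i < length gs" for i
    using nth_mem[OF that] S unfolding gs by auto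
  let ?I = "{..<length gs}" and ?x = "\<lambda>i. act (gs ! i)"
  have words_N: "E.ev ?x w \<in> act ` N" if "w \<in> lists ?I" for w
    using that
  proof (induction w)
    case Nil
    show ?case using N.one_closed act_one by force
  next
    case (Cons i w)
    then obtain h where h: "h \<in> N" "E.ev ?x w = act h" by auto
    have "E.ev ?x (i # w) = act (gs ! i \<otimes>\<^bsub>G\<^esub> h)"
      using h gsN[of i] Cons.hyps by (simp add: act_mult)
    then show ?case using h gsN[of i] Cons.hyps by blast
  qed
  have H: "generate G S \<subseteq> N" using generate_subgroup_incl[OF _ N] S by blast
  have gen_words: "act h \<in> E.ev ?x ` lists ?I" if "h \<in> generate G S" for h
    using that
  proof (induction rule: generate.induct)
    case one
    show ?case by (intro image_eqI[of _ _ "[]"]) (auto simp: act_one)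
  next
    case (incl h)
    then obtain i where "i < length gs" "gs ! i = h" using gs in_set_conv_nth[of h gs] by blast
    then show ?case by (intro image_eqI[of _ _ "[i]"]) auto
  next
    case (inv h)
    then obtain i where "i < length gs" "gs ! i = inv\<^bsub>G\<^esub> h"
      using gs in_set_conv_nth[of "inv\<^bsub>G\<^esub> h" gs] by blast
    then show ?case by (intro image_eqI[of _ _ "[i]"]) auto
  next
    case (eng g h)
    then obtain v w where vw: "v \<in> lists ?I" "act g = E.ev ?x v" "w \<in> lists ?I" "act h = E.ev ?x w" by blast
    have "g \<in> carrier G" "h \<in> carrier G" using eng.hyps H N.subset by blast+
    then show ?case using vw by (intro image_eqI[of _ _ "v @ w"]) (auto simp: act_mult)
  qed
  have unipN: "\<exists>k. (act g - 1) ^ k = 0" if "g \<in> N" for g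
    using unip that unfolding unipotent_iff[OF N.subset] by blast
  have "\<exists>L. \<forall>hs. set hs \<subseteq> E.ev ?x ` lists ?I \<and> length hs = L \<longrightarrow> prod_list (map (\<lambda>h. h - 1) hs) = 0"
  proof (rule E.unipotent_monoid_nilpotent[OF finite_lessThan _ _ id])
    show "E.lin (?x i)" if "i \<in> ?I" for i
      by (rule act_lin) (use gsN[of i] that N.subset in auto)
    show "\<exists>k. (E.ev ?x w - 1) ^ k = 0" if w: "w \<in> lists ?I" for w
      using words_N[OF w] unipN by auto
    have "E.ev ?x ` lists ?I \<subseteq> act ` carrier G" using words_N N.subset by blast
    then show "E.span (E.ev ?x ` lists ?I) \<subseteq> E.span (act ` carrier G)" by (rule E.span_mono)
  qed
  then obtain L where L: "\<And>hs. set hs \<subseteq> E.ev ?x ` lists ?I \<Longrightarrow> length hs = L \<Longrightarrow> prod_list (map (\<lambda>h. h - 1) hs) = 0"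
    by blast
  have "prod_list (map (\<lambda>g. act g - 1) hs) = 0" if hs: "set hs \<subseteq> generate G S" "length hs = L" for hs
    using L[of "map act hs"] hs gen_words by (auto simp: o_def)
  then show "unitriangular_rep (G\<lparr>carrier := generate G S\<rparr>) \<rho>"
    unfolding unitriangular_iff[OF subset_trans[OF H N.subset]] by blast
qed

text \<open>In the subgroup generated by \<open>g\<close> alone, a product of \<open>n\<close> equal
  factors \<open>g - 1\<close> is the required power.\<close>

lemma locally_unitriangular_imp_unipotent:
  assumes N: "subgroup N G" and lu: "locally_unitriangular_rep (G\<lparr>carrier := N\<rparr>) \<rho>"
  shows "unipotent_rep (G\<lparr>carrier := N\<rparr>) \<rho>"
proof -
  interpret N: subgroup N G by (fact N)
  have "\<exists>n. (act g - 1) ^ n = 0" if g: "g \<in> N" for g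
  proof -
    have "unitriangular_rep (G\<lparr>carrier := generate G {g}\<rparr>) \<rho>"
      using lu g unfolding locally_unitriangular_iff[OF N] by simp
    moreover have "generate G {g} \<subseteq> carrier G" using g by (intro generate_incl) auto
    ultimately obtain n where n: "\<And>gs. set gs \<subseteq> generate G {g} \<Longrightarrow> length gs = n \<Longrightarrow>
        prod_list (map (\<lambda>g. act g - 1) gs) = 0"
      by (auto simp: unitriangular_iff)
    have "set (replicate n g) \<subseteq> generate G {g}" by (auto intro: generate.incl)
    from n[OF this] have "prod_list (replicate n (act g - 1)) = 0" by (simp add: map_replicate)
    moreover have "prod_list (replicate n y) = y ^ n" for y :: "'v endo" by (induction n) auto
    ultimately show ?thesis by metis
  qed
  then show ?thesis by (simp add: unipotent_iff[OF N.subset])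
qed

text \<open>The conjugates of \<open>a\<close> by powers of \<open>b\<close> stay in the normal
  subgroup \<open>N1\<close>, which is locally unitriangular; this gives the vanishing products that
  \<open>unipotent_mult\<close> demands.\<close>

lemma unipotent_product:
  assumes PI: "PI_rep scale G \<rho>" and N1: "N1 \<lhd> G" "unipotent_rep (G\<lparr>carrier := N1\<rparr>) \<rho>"
    and N2: "subgroup N2 G" "unipotent_rep (G\<lparr>carrier := N2\<rparr>) \<rho>" and ab: "a \<in> N1" "b \<in> N2"
  shows "\<exists>r. (act (a \<otimes>\<^bsub>G\<^esub> b) - 1) ^ r = 0"
proof -
  interpret N1: normal N1 G by (fact N1(1))
  interpret N2: subgroup N2 G by (fact N2(1))
  have carr: "a \<in> carrier G" "b \<in> carrier G" using ab by auto
  let ?c = "\<lambda>i::nat. b [^]\<^bsub>G\<^esub> i \<otimes>\<^bsub>G\<^esub> a \<otimes>\<^bsub>G\<^esub> inv\<^bsub>G\<^esub> (b [^]\<^bsub>G\<^esub> i)"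
  have cN: "?c i \<in> N1" for i using ab(1) carr(2) N1.inv_op_closed2 by simp
  have conj: "act b ^ i * (act a - 1) * act (inv\<^bsub>G\<^esub> b) ^ i = act (?c i) - 1" for i
  proof -
    have "act b ^ i * act (inv\<^bsub>G\<^esub> b) ^ i = 1"
      using carr(2) by (simp flip: act_pow act_mult add: nat_pow_inv act_one)
    moreover have "act (?c i) = act b ^ i * act a * act (inv\<^bsub>G\<^esub> b) ^ i"
      using carr by (simp add: act_mult act_pow flip: nat_pow_inv)
    ultimately show ?thesis by (simp add: algebra_simps)
  qed
  have unip: "\<exists>m. (act h - 1) ^ m = 0" if "h \<in> N2" for h
    using N2(2) that unfolding unipotent_iff[OF N2.subset] by (rule bspec)
  obtain m where m: "(act b - 1) ^ m = 0" using unip[OF ab(2)] ..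
  obtain m' where m': "(act (inv\<^bsub>G\<^esub> b) - 1) ^ m' = 0" using unip[OF N2.m_inv_closed[OF ab(2)]] ..
  have "\<exists>r. (act a * act b - 1) ^ r = 0"
  proof (rule E.unipotent_mult[of "act b" "act (inv\<^bsub>G\<^esub> b)" "act a" m m'])
    show "act b * act (inv\<^bsub>G\<^esub> b) = 1" "act (inv\<^bsub>G\<^esub> b) * act b = 1"
      by (rule act_inv[OF carr(2)])+
    show "E.lin (act a)" "E.lin (act b)" "E.lin (act (inv\<^bsub>G\<^esub> b))"
      using carr by (simp_all add: act_lin)
    show "(act b - 1) ^ m = 0" "(act (inv\<^bsub>G\<^esub> b) - 1) ^ m' = 0" by (fact m m')+
  next
    fix F :: "nat set" assume F: "finite F"
    let ?H = "generate G (?c ` F)"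
    have "finite (?c ` F) \<and> ?c ` F \<subseteq> N1" using cN F by auto
    then have "unitriangular_rep (G\<lparr>carrier := ?H\<rparr>) \<rho>"
      using unipotent_imp_locally_unitriangular[OF PI N1.subgroup_axioms N1(2)]
      unfolding locally_unitriangular_iff[OF N1.subgroup_axioms] by simp
    moreover have "?H \<subseteq> carrier G" using cN N1.subset by (intro generate_incl) auto
    ultimately obtain k where k: "\<And>gs. set gs \<subseteq> ?H \<Longrightarrow> length gs = k \<Longrightarrow>
        prod_list (map (\<lambda>g. act g - 1) gs) = 0"
      by (auto simp: unitriangular_iff)
    have "prod_list es = 0" if es: "set es \<subseteq> (\<lambda>i. act (?c i) - 1) ` F" "length es = k" for es
    proof -
      from es(1) have "es \<in> lists ((\<lambda>i. act (?c i) - 1) ` F)" by (simp add: lists_eq_set)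
      then obtain js where js: "set js \<subseteq> F" "es = map (\<lambda>i. act (?c i) - 1) js"
        unfolding lists_image by (auto simp: lists_eq_set)
      have "set (map ?c js) \<subseteq> ?H" using js(1) by (auto intro!: generate.incl)
      from k[OF this] show ?thesis using js(2) es(2) by (simp add: o_def)
    qed
    then show "\<exists>k. \<forall>es. set es \<subseteq> (\<lambda>i. act b ^ i * (act a - 1) * act (inv\<^bsub>G\<^esub> b) ^ i) ` F \<and> length es = k
        \<longrightarrow> prod_list es = 0"
      unfolding conj by blast
  qed
  then show ?thesis using carr by (simp add: act_mult)
qed

theorem unipotent_radical:
  assumes PI: "PI_rep scale G \<rho>"
  shows "\<exists>H. is_unipotent_radical G \<rho> H \<and> is_locally_unitriangular_radical G \<rho> H"
proof -
  define U where "U N \<longleftrightarrow> unipotent_rep (G\<lparr>carrier := N\<rparr>) \<rho>" for N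
  define R where "R = \<Union>{N. N \<lhd> G \<and> U N}"
  have sub: "N \<subseteq> carrier G" if "N \<lhd> G" for N
    using that normal_imp_subgroup subgroup.subset by blast
  have R_carr: "R \<subseteq> carrier G" unfolding R_def using sub by blast
  have "U {\<one>\<^bsub>G\<^esub>}" unfolding U_def by (subst unipotent_iff) (auto simp: act_one intro!: exI[of _ 1])
  then have R_one: "\<one>\<^bsub>G\<^esub> \<in> R" unfolding R_def using one_is_normal by blast
  have R_mult: "a \<otimes>\<^bsub>G\<^esub> b \<in> R" if ab: "a \<in> R" "b \<in> R" for a b
  proof -
    obtain N1 N2 where N1: "N1 \<lhd> G" "U N1" "a \<in> N1" and N2: "N2 \<lhd> G" "U N2" "b \<in> N2"
      using ab unfolding R_def by blast
    have "N1 <#>\<^bsub>G\<^esub> N2 \<lhd> G" by (rule normal_subgroup_set_mult_closed[OF N1(1) N2(1)])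
    moreover have "U (N1 <#>\<^bsub>G\<^esub> N2)"
      unfolding U_def unipotent_iff[OF sub[OF \<open>N1 <#>\<^bsub>G\<^esub> N2 \<lhd> G\<close>]]
    proof
      fix g assume "g \<in> N1 <#>\<^bsub>G\<^esub> N2"
      then obtain a b where g: "a \<in> N1" "b \<in> N2" "g = a \<otimes>\<^bsub>G\<^esub> b" unfolding set_mult_def by blast
      show "\<exists>r. (act g - 1) ^ r = 0"
        unfolding g(3) by (rule unipotent_product[OF PI N1(1) N1(2)[unfolded U_def]
              normal_imp_subgroup[OF N2(1)] N2(2)[unfolded U_def] g(1,2)])
    qed
    moreover have "a \<otimes>\<^bsub>G\<^esub> b \<in> N1 <#>\<^bsub>G\<^esub> N2" unfolding set_mult_def using N1(3) N2(3) by blast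
    ultimately show ?thesis unfolding R_def by blast
  qed
  have R_normal: "R \<lhd> G"
    unfolding normal_inv_iff
  proof (intro conjI ballI)
    show "subgroup R G"
    proof (rule subgroupI)
      show "R \<subseteq> carrier G" by (rule R_carr)
      show "R \<noteq> {}" using R_one by blast
      show "a \<otimes>\<^bsub>G\<^esub> b \<in> R" if "a \<in> R" "b \<in> R" for a b using that by (rule R_mult)
      fix a assume "a \<in> R"
      then obtain N where N: "N \<lhd> G" "U N" "a \<in> N" unfolding R_def by blast
      have "inv\<^bsub>G\<^esub> a \<in> N" by (rule subgroup.m_inv_closed[OF normal_imp_subgroup[OF N(1)] N(3)])
      with N show "inv\<^bsub>G\<^esub> a \<in> R" unfolding R_def by blast
    qed
    fix x h assume x: "x \<in> carrier G" and "h \<in> R"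
    then obtain N where N: "N \<lhd> G" "U N" "h \<in> N" unfolding R_def by blast
    have "x \<otimes>\<^bsub>G\<^esub> h \<otimes>\<^bsub>G\<^esub> inv\<^bsub>G\<^esub> x \<in> N" by (rule normal.inv_op_closed2[OF N(1) x N(3)])
    with N show "x \<otimes>\<^bsub>G\<^esub> h \<otimes>\<^bsub>G\<^esub> inv\<^bsub>G\<^esub> x \<in> R" unfolding R_def by blast
  qed
  have R_U: "U R"
    unfolding U_def unipotent_iff[OF R_carr]
  proof
    fix g assume "g \<in> R"
    then obtain N where "N \<lhd> G" "U N" "g \<in> N" unfolding R_def by blast
    then show "\<exists>n. (act g - 1) ^ n = 0" unfolding U_def unipotent_iff[OF sub[OF \<open>N \<lhd> G\<close>]] by blast
  qed
  \<comment> \<open>Stated for any property that agrees with \<open>U\<close> on normal subgroups,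
    so it yields both radicals. \<open>R\<close> contains every such subgroup and is therefore the
    only maximal one.\<close>
  have max: "unique_maximal_normal_with P G R" if P: "\<And>N. N \<lhd> G \<Longrightarrow> P N \<longleftrightarrow> U N" for P
  proof -
    have le: "N \<subseteq> R" if "N \<lhd> G" "P N" for N using that P unfolding R_def by blast
    have "P R" using P R_normal R_U by blast
    with le R_normal show ?thesis
      unfolding unique_maximal_normal_with_def maximal_normal_with_def by blast
  qed
  have "locally_unitriangular_rep (G\<lparr>carrier := N\<rparr>) \<rho> \<longleftrightarrow> U N" if "N \<lhd> G" for N
    unfolding U_def using unipotent_imp_locally_unitriangular[OF PI normal_imp_subgroup[OF that]]
      locally_unitriangular_imp_unipotent[OF normal_imp_subgroup[OF that]] by (rule iffI[rotated])
  then have "is_locally_unitriangular_radical G \<rho> R"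
    unfolding is_locally_unitriangular_radical_def by (rule max)
  moreover have "is_unipotent_radical G \<rho> R"
    unfolding is_unipotent_radical_def by (rule max) (simp add: U_def)
  ultimately show ?thesis by blast
qed

end

theorem theorem1p23:
  fixes scale :: "'k::field \<Rightarrow> 'v::ab_group_add \<Rightarrow> 'v"
    and G :: "('g, 'b) monoid_scheme"
    and \<rho> :: "'g \<Rightarrow> 'v \<Rightarrow> 'v"
  assumes "group_rep scale G \<rho>"
    and "PI_rep scale G \<rho>"
  shows "\<exists>H. is_unipotent_radical G \<rho> H \<and> is_locally_unitriangular_radical G \<rho> H"
  by (rule group_rep.unipotent_radical[OF assms])

end
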